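(* For every $d=1,2,3,4$, the quantum graph $\mathcal{G}_d=(M_2,\tau,A_d)$ and the classical graph $\mathcal{G}'_d=(\mathbb{C}^4,\tau_{\mathbb{C}^4},A'_d)$ on four vertices are quantum isomorphic. Here $\tau=\mathrm{Tr}/2$, $\tau_{\mathbb{C}^4}=\mathrm{Tr}/4$; with respect to the orthonormal basis $(\sqrt2e_{11},\sqrt2e_{12},\sqrt2e_{21},\sqrt2e_{22})$ of $L^2(M_2,\tau)$, $$A_1=\mathrm{id},\quad A_2=\begin{pmatrix}2&0&0&0\\0&0&0&0\\0&0&0&0\\0&0&0&2\end{pmatrix},\quad A_3=\begin{pmatrix}1&0&0&2\\0&1&0&0\\0&0&1&0\\2&0&0&1\end{pmatrix},\quad A_4=\begin{pmatrix}2&0&0&2\\0&0&0&0\\0&0&0&0\\2&0&0&2\end{pmatrix};$$ and with respect to the standard basis of $\mathbb{C}^4$, $$A'_1=I_4,\quad A'_2=\begin{pmatrix}1&1&0&0\\1&1&0&0\\0&0&1&1\\0&0&1&1\end{pmatrix},\quad A'_3=\begin{pmatrix}1&0&1&1\\0&1&1&1\\1&1&1&0\\1&1&0&1\end{pmatrix},\quad A'_4=\text{the all-ones matrix}.$$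
   Context: $\mathbb{C}^4$ is the algebra of diagonal $4\times4$ matrices. A quantum graph $(B,\psi,A)$ consists of a finite-dimensional unital $C^*$-algebra $B$, a faithful state $\psi$ with $mm^\dagger=\delta^2\mathrm{id}_B$ for some $\delta>0$ ($m$ the multiplication map, $\dagger$ the Hilbert adjoint for $\langle x|y\rangle=\psi(x^*y)$ and $\psi\otimes\psi$), and a linear operator $A:B\to B$ with $m(A\otimes A)m^\dagger=\delta^2A$. A quantum isomorphism $(H,P):(B',\psi',A')\to(B,\psi,A)$ is a pair of a finite-dimensional Hilbert space $H$ and a linear operator $P:B\otimes H\to H\otimes B'$ such that: writing $P(b\otimes h)=\sum_kP^k(b)h\otimes e'_k$ for a basis $\{e'_k\}$ of $B'$ and $\tilde P(b)=\sum_ke'_k\otimes P^k(b)$, the map $\tilde P:B\to B'\otimes B(H)$ is a unital $*$-homomorphism; $(\mathrm{id}_H\otimes\psi')P=\psi\otimes\mathrm{id}_H$; $(P\otimes\mathrm{id}_{B'})(\mathrm{id}_B\otimes P)(m^\dagger\otimes\mathrm{id}_H)=(\mathrm{id}_H\otimes m'^\dagger)P$; and $P(A\otimes\mathrm{id}_H)=(\mathrm{id}_H\otimes A')P$. Two quantum graphs are quantum isomorphic if there is a nonzero quantum isomorphism between them. *)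

theory Defs
  imports Complex_Main
begin

text \<open>
  A finite-dimensional complex vector space is presented by a finite index set \<open>I\<close> of basis
  vectors: its elements are the functions \<open>'i \<Rightarrow> complex\<close> supported in \<open>I\<close>. The tensor product of
  the spaces over \<open>I\<close> and \<open>J\<close> is then the space over \<open>I \<times> J\<close>. The behaviour of operators outside
  these carriers is irrelevant.
\<close>

definition cspace :: "'i set \<Rightarrow> ('i \<Rightarrow> complex) set" where
  "cspace I = {x. \<forall>i. i \<notin> I \<longrightarrow> x i = 0}"

definition bvec :: "'i \<Rightarrow> 'i \<Rightarrow> complex" where
  "bvec i = (\<lambda>k. if k = i then 1 else 0)"

definition linear_op :: "'i set \<Rightarrow> 'j set \<Rightarrow> (('i \<Rightarrow> complex) \<Rightarrow> ('j \<Rightarrow> complex)) \<Rightarrow> bool" where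
  "linear_op I J T \<longleftrightarrow>
     (\<forall>x\<in>cspace I. T x \<in> cspace J) \<and>
     (\<forall>x\<in>cspace I. \<forall>y\<in>cspace I. T (\<lambda>i. x i + y i) = (\<lambda>j. T x j + T y j)) \<and>
     (\<forall>c. \<forall>x\<in>cspace I. T (\<lambda>i. c * x i) = (\<lambda>j. c * T x j))"

definition linear_functional :: "'i set \<Rightarrow> (('i \<Rightarrow> complex) \<Rightarrow> complex) \<Rightarrow> bool" where
  "linear_functional I f \<longleftrightarrow>
     (\<forall>x\<in>cspace I. \<forall>y\<in>cspace I. f (\<lambda>i. x i + y i) = f x + f y) \<and>
     (\<forall>c. \<forall>x\<in>cspace I. f (\<lambda>i. c * x i) = c * f x)"

definition tens :: "('i \<Rightarrow> complex) \<Rightarrow> ('j \<Rightarrow> complex) \<Rightarrow> 'i \<times> 'j \<Rightarrow> complex" where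
  "tens x y = (\<lambda>(i, j). x i * y j)"

text \<open>
  For linear \<open>S\<close> and \<open>T\<close>, \<open>S \<otimes> id\<close> and \<open>id \<otimes> T\<close> act slicewise; functionals are treated in the same
  way, identifying \<open>\<complex> \<otimes> V\<close> and \<open>V \<otimes> \<complex>\<close> with \<open>V\<close>.
\<close>

definition op_id :: "(('i \<Rightarrow> complex) \<Rightarrow> ('p \<Rightarrow> complex)) \<Rightarrow> ('i \<times> 'j \<Rightarrow> complex) \<Rightarrow> 'p \<times> 'j \<Rightarrow> complex" where
  "op_id S z = (\<lambda>(p, j). S (\<lambda>i. z (i, j)) p)"

definition id_op :: "(('j \<Rightarrow> complex) \<Rightarrow> ('q \<Rightarrow> complex)) \<Rightarrow> ('i \<times> 'j \<Rightarrow> complex) \<Rightarrow> 'i \<times> 'q \<Rightarrow> complex" where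
  "id_op T z = (\<lambda>(i, q). T (\<lambda>j. z (i, j)) q)"

definition fun_id :: "(('i \<Rightarrow> complex) \<Rightarrow> complex) \<Rightarrow> ('i \<times> 'j \<Rightarrow> complex) \<Rightarrow> 'j \<Rightarrow> complex" where
  "fun_id f z = (\<lambda>j. f (\<lambda>i. z (i, j)))"

definition id_fun :: "(('j \<Rightarrow> complex) \<Rightarrow> complex) \<Rightarrow> ('i \<times> 'j \<Rightarrow> complex) \<Rightarrow> 'i \<Rightarrow> complex" where
  "id_fun f z = (\<lambda>i. f (\<lambda>j. z (i, j)))"

definition op_tensor ::
  "(('i \<Rightarrow> complex) \<Rightarrow> ('p \<Rightarrow> complex)) \<Rightarrow> (('j \<Rightarrow> complex) \<Rightarrow> ('q \<Rightarrow> complex)) \<Rightarrow>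
   ('i \<times> 'j \<Rightarrow> complex) \<Rightarrow> 'p \<times> 'q \<Rightarrow> complex" where
  "op_tensor S T z = op_id S (id_op T z)"

definition assoc_right :: "(('i \<times> 'j) \<times> 'k \<Rightarrow> complex) \<Rightarrow> 'i \<times> ('j \<times> 'k) \<Rightarrow> complex" where
  "assoc_right z = (\<lambda>(i, (j, k)). z ((i, j), k))"

definition assoc_left :: "('i \<times> ('j \<times> 'k) \<Rightarrow> complex) \<Rightarrow> ('i \<times> 'j) \<times> 'k \<Rightarrow> complex" where
  "assoc_left z = (\<lambda>((i, j), k). z (i, (j, k)))"


record 'i star_alg =
  idx  :: "'i set"
  mul  :: "('i \<Rightarrow> complex) \<Rightarrow> ('i \<Rightarrow> complex) \<Rightarrow> ('i \<Rightarrow> complex)"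
  unt  :: "'i \<Rightarrow> complex"
  star :: "('i \<Rightarrow> complex) \<Rightarrow> ('i \<Rightarrow> complex)"

abbreviation carr :: "('i, 'm) star_alg_scheme \<Rightarrow> ('i \<Rightarrow> complex) set" where
  "carr B \<equiv> cspace (idx B)"

definition star_algebra :: "('i, 'm) star_alg_scheme \<Rightarrow> bool" where
  "star_algebra B \<longleftrightarrow>
     finite (idx B) \<and> unt B \<in> carr B \<and>
     (\<forall>x\<in>carr B. linear_op (idx B) (idx B) (mul B x)) \<and>
     (\<forall>y\<in>carr B. linear_op (idx B) (idx B) (\<lambda>x. mul B x y)) \<and>
     (\<forall>x\<in>carr B. \<forall>y\<in>carr B. \<forall>z\<in>carr B. mul B (mul B x y) z = mul B x (mul B y z)) \<and>
     (\<forall>x\<in>carr B. mul B (unt B) x = x \<and> mul B x (unt B) = x) \<and>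
     (\<forall>x\<in>carr B. star B x \<in> carr B \<and> star B (star B x) = x) \<and>
     (\<forall>x\<in>carr B. \<forall>y\<in>carr B. star B (\<lambda>i. x i + y i) = (\<lambda>i. star B x i + star B y i)) \<and>
     (\<forall>c. \<forall>x\<in>carr B. star B (\<lambda>i. c * x i) = (\<lambda>i. cnj c * star B x i)) \<and>
     (\<forall>x\<in>carr B. \<forall>y\<in>carr B. star B (mul B x y) = mul B (star B y) (star B x))"

text \<open>
  A C*-norm on a *-algebra. Completeness is automatic in finite dimension, and there is at most one
  such norm, so it is not made part of the record.
\<close>

definition cstar_norm :: "('i, 'm) star_alg_scheme \<Rightarrow> (('i \<Rightarrow> complex) \<Rightarrow> real) \<Rightarrow> bool" where
  "cstar_norm B N \<longleftrightarrow>
     (\<forall>x\<in>carr B. 0 \<le> N x \<and> (N x = 0 \<longleftrightarrow> x = (\<lambda>i. 0))) \<and>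
     (\<forall>c. \<forall>x\<in>carr B. N (\<lambda>i. c * x i) = cmod c * N x) \<and>
     (\<forall>x\<in>carr B. \<forall>y\<in>carr B. N (\<lambda>i. x i + y i) \<le> N x + N y) \<and>
     (\<forall>x\<in>carr B. \<forall>y\<in>carr B. N (mul B x y) \<le> N x * N y) \<and>
     (\<forall>x\<in>carr B. N (mul B (star B x) x) = (N x)\<^sup>2)"

definition fd_cstar_algebra :: "('i, 'm) star_alg_scheme \<Rightarrow> bool" where
  "fd_cstar_algebra B \<longleftrightarrow> star_algebra B \<and> (\<exists>N. cstar_norm B N)"

definition unital_star_hom ::
  "('i, 'm) star_alg_scheme \<Rightarrow> ('j, 'n) star_alg_scheme \<Rightarrow> (('i \<Rightarrow> complex) \<Rightarrow> ('j \<Rightarrow> complex)) \<Rightarrow> bool" where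
  "unital_star_hom B C f \<longleftrightarrow>
     linear_op (idx B) (idx C) f \<and>
     (\<forall>x\<in>carr B. \<forall>y\<in>carr B. f (mul B x y) = mul C (f x) (f y)) \<and>
     f (unt B) = unt C \<and>
     (\<forall>x\<in>carr B. f (star B x) = star C (f x))"

text \<open>
  The matrix algebra over the index set \<open>K\<close>. It also serves as \<open>B(H)\<close> for the Hilbert space
  \<open>H = \<complex>\<^sup>K\<close> with its standard orthonormal basis.
\<close>

definition mat_alg :: "'k set \<Rightarrow> ('k \<times> 'k) star_alg" where
  "mat_alg K = \<lparr>
     idx = K \<times> K,
     mul = (\<lambda>x y. \<lambda>(i, j). \<Sum>k\<in>K. x (i, k) * y (k, j)),
     unt = (\<lambda>(i, j). if i = j \<and> i \<in> K then 1 else 0),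
     star = (\<lambda>x. \<lambda>(i, j). cnj (x (j, i))) \<rparr>"

text \<open>The algebra of diagonal \<open>K \<times> K\<close> matrices, an element being given by its diagonal entries.\<close>

definition diag_alg :: "'k set \<Rightarrow> 'k star_alg" where
  "diag_alg K = \<lparr>
     idx = K,
     mul = (\<lambda>x y i. x i * y i),
     unt = (\<lambda>i. if i \<in> K then 1 else 0),
     star = (\<lambda>x i. cnj (x i)) \<rparr>"

text \<open>The (bi)linear, respectively conjugate-linear, extensions of
  \<open>(a \<otimes> b) (c \<otimes> d) = ac \<otimes> bd\<close> and \<open>(a \<otimes> b)* = a* \<otimes> b*\<close>.\<close>

definition tensor_alg ::
  "('i, 'm) star_alg_scheme \<Rightarrow> ('j, 'n) star_alg_scheme \<Rightarrow> ('i \<times> 'j) star_alg" where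
  "tensor_alg B C = \<lparr>
     idx = idx B \<times> idx C,
     mul = (\<lambda>z w pq. \<Sum>(i, j)\<in>idx B \<times> idx C. \<Sum>(k, l)\<in>idx B \<times> idx C.
              z (i, j) * w (k, l) *
              tens (mul B (bvec i) (bvec k)) (mul C (bvec j) (bvec l)) pq),
     unt = tens (unt B) (unt C),
     star = (\<lambda>z pq. \<Sum>(i, j)\<in>idx B \<times> idx C.
              cnj (z (i, j)) * tens (star B (bvec i)) (star C (bvec j)) pq) \<rparr>"

definition mult_map :: "('i, 'm) star_alg_scheme \<Rightarrow> ('i \<times> 'i \<Rightarrow> complex) \<Rightarrow> ('i \<Rightarrow> complex)" where
  "mult_map B z = (\<lambda>p. \<Sum>(i, j)\<in>idx B \<times> idx B. z (i, j) * mul B (bvec i) (bvec j) p)"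


record 'i qgraph = "'i star_alg" +
  state :: "('i \<Rightarrow> complex) \<Rightarrow> complex"
  adj   :: "('i \<Rightarrow> complex) \<Rightarrow> ('i \<Rightarrow> complex)"

definition faithful_state :: "('i, 'm) star_alg_scheme \<Rightarrow> (('i \<Rightarrow> complex) \<Rightarrow> complex) \<Rightarrow> bool" where
  "faithful_state B \<psi> \<longleftrightarrow>
     linear_functional (idx B) \<psi> \<and>
     (\<forall>x\<in>carr B. Im (\<psi> (mul B (star B x) x)) = 0 \<and> 0 \<le> Re (\<psi> (mul B (star B x) x))) \<and>
     \<psi> (unt B) = 1 \<and>
     (\<forall>x\<in>carr B. \<psi> (mul B (star B x) x) = 0 \<longrightarrow> x = (\<lambda>i. 0))"

definition inner_of ::
  "('i, 'm) star_alg_scheme \<Rightarrow> (('i \<Rightarrow> complex) \<Rightarrow> complex) \<Rightarrow> ('i \<Rightarrow> complex) \<Rightarrow> ('i \<Rightarrow> complex) \<Rightarrow> complex" where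
  "inner_of B \<psi> x y = \<psi> (mul B (star B x) y)"

definition state_tensor ::
  "(('i \<Rightarrow> complex) \<Rightarrow> complex) \<Rightarrow> (('j \<Rightarrow> complex) \<Rightarrow> complex) \<Rightarrow> ('i \<times> 'j \<Rightarrow> complex) \<Rightarrow> complex" where
  "state_tensor \<phi> \<psi> z = \<phi> (id_fun \<psi> z)"

text \<open>The Hilbert adjoint of an operator \<open>T\<close> whose domain is the space over \<open>J\<close> with inner product
  \<open>ipJ\<close> and whose codomain has inner product \<open>ipI\<close>; the vector is unique when \<open>ipJ\<close> is
  non-degenerate.\<close>

definition hilbert_adjoint ::
  "'j set \<Rightarrow> (('j \<Rightarrow> complex) \<Rightarrow> ('j \<Rightarrow> complex) \<Rightarrow> complex) \<Rightarrow>
   (('i \<Rightarrow> complex) \<Rightarrow> ('i \<Rightarrow> complex) \<Rightarrow> complex) \<Rightarrow>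
   (('j \<Rightarrow> complex) \<Rightarrow> ('i \<Rightarrow> complex)) \<Rightarrow> ('i \<Rightarrow> complex) \<Rightarrow> ('j \<Rightarrow> complex)" where
  "hilbert_adjoint J ipJ ipI T x =
     (THE w. w \<in> cspace J \<and> (\<forall>z\<in>cspace J. ipJ w z = ipI x (T z)))"

definition comult :: "('i, 'm) qgraph_scheme \<Rightarrow> ('i \<Rightarrow> complex) \<Rightarrow> 'i \<times> 'i \<Rightarrow> complex" where
  "comult G =
     hilbert_adjoint (idx G \<times> idx G)
       (inner_of (tensor_alg G G) (state_tensor (state G) (state G)))
       (inner_of G (state G))
       (mult_map G)"

definition quantum_graph :: "('i, 'm) qgraph_scheme \<Rightarrow> bool" where
  "quantum_graph G \<longleftrightarrow>
     fd_cstar_algebra G \<and>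
     faithful_state G (state G) \<and>
     linear_op (idx G) (idx G) (adj G) \<and>
     (\<exists>\<delta>>0. 
        (\<forall>x\<in>carr G. mult_map G (comult G x) = (\<lambda>i. complex_of_real (\<delta>\<^sup>2) * x i)) \<and>
        (\<forall>x\<in>carr G. mult_map G (op_tensor (adj G) (adj G) (comult G x)) =
                      (\<lambda>i. complex_of_real (\<delta>\<^sup>2) * adj G x i)))"


text \<open>
  For \<open>P : B \<otimes> H \<rightarrow> H \<otimes> B'\<close> with \<open>H = \<complex>\<^sup>K\<close>, write \<open>P(b \<otimes> h) = \<Sum>\<^sub>k P\<^sup>k(b)h \<otimes> e'\<^sub>k\<close> in the coordinate
  basis of \<open>B'\<close>; \<open>P_tilde P b\<close> is \<open>\<Sum>\<^sub>k e'\<^sub>k \<otimes> P\<^sup>k(b)\<close>, the \<open>(h', h)\<close> entry of \<open>P\<^sup>k(b)\<close> being its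
  matrix coefficient (row \<open>h'\<close>, column \<open>h\<close>).
\<close>

definition P_tilde ::
  "(('i \<times> 'k \<Rightarrow> complex) \<Rightarrow> ('k \<times> 'j \<Rightarrow> complex)) \<Rightarrow> 'k set \<Rightarrow> ('i \<Rightarrow> complex) \<Rightarrow> 'j \<times> ('k \<times> 'k) \<Rightarrow> complex" where
  "P_tilde P K b = (\<lambda>(k, (h', h)). if h \<in> K then P (tens b (bvec h)) (h', k) else 0)"

text \<open>\<open>quantum_isomorphism K P G' G\<close>: the pair \<open>(\<complex>\<^sup>K, P)\<close> is a quantum isomorphism from \<open>G'\<close> to \<open>G\<close>.\<close>

definition quantum_isomorphism ::
  "'k set \<Rightarrow> (('i \<times> 'k \<Rightarrow> complex) \<Rightarrow> ('k \<times> 'j \<Rightarrow> complex)) \<Rightarrow> 'j qgraph \<Rightarrow> 'i qgraph \<Rightarrow> bool" where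
  "quantum_isomorphism K P G' G \<longleftrightarrow>
     finite K \<and>
     linear_op (idx G \<times> K) (K \<times> idx G') P \<and>
     unital_star_hom G (tensor_alg G' (mat_alg K)) (P_tilde P K) \<and>
     (\<forall>z\<in>cspace (idx G \<times> K). id_fun (state G') (P z) = fun_id (state G) z) \<and>
     (\<forall>z\<in>cspace (idx G \<times> K).
        op_id P (assoc_left (id_op P (assoc_right (op_id (comult G) z)))) =
        assoc_left (id_op (comult G') (P z))) \<and>
     (\<forall>z\<in>cspace (idx G \<times> K). P (op_id (adj G) z) = id_op (adj G') (P z))"

text \<open>Every finite-dimensional Hilbert space is \<open>\<complex>\<^sup>n\<close> up to unitary equivalence.\<close>

definition quantum_isomorphic :: "'j qgraph \<Rightarrow> 'i qgraph \<Rightarrow> bool" where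
  "quantum_isomorphic G' G \<longleftrightarrow>
     (\<exists>(n::nat) P. quantum_isomorphism {..<n} P G' G \<and>
        (\<exists>z\<in>cspace (idx G \<times> {..<n}). P z \<noteq> (\<lambda>p. 0)))"


text \<open>Matrix units \<open>e\<^sub>1\<^sub>1, e\<^sub>1\<^sub>2, \<dots>\<close> are \<open>bvec (0, 0), bvec (0, 1), \<dots>\<close>; matrices of operators are lists of
  rows.\<close>

definition tau_M2 :: "(nat \<times> nat \<Rightarrow> complex) \<Rightarrow> complex" where
  "tau_M2 x = (\<Sum>i<2. x (i, i)) / 2"

definition tau_C4 :: "(nat \<Rightarrow> complex) \<Rightarrow> complex" where
  "tau_C4 x = (\<Sum>i<4. x i) / 4"

definition onb_M2 :: "(nat \<times> nat \<Rightarrow> complex) list" where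
  "onb_M2 = map (\<lambda>p q. complex_of_real (sqrt 2) * bvec p q) [(0, 0), (0, 1), (1, 0), (1, 1)]"

definition op_M2 :: "complex list list \<Rightarrow> (nat \<times> nat \<Rightarrow> complex) \<Rightarrow> (nat \<times> nat \<Rightarrow> complex)" where
  "op_M2 M x = (\<lambda>p. \<Sum>i<4. \<Sum>j<4.
     M ! i ! j * inner_of (mat_alg {..<2}) tau_M2 (onb_M2 ! j) x * (onb_M2 ! i) p)"

definition op_C4 :: "complex list list \<Rightarrow> (nat \<Rightarrow> complex) \<Rightarrow> (nat \<Rightarrow> complex)" where
  "op_C4 M x = (\<lambda>p. \<Sum>i<4. \<Sum>j<4. M ! i ! j * x j * bvec i p)"

definition A_M2 :: "nat \<Rightarrow> complex list list" where
  "A_M2 d =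
    (if d = 1 then
       [[1, 0, 0, 0],
        [0, 1, 0, 0],
        [0, 0, 1, 0],
        [0, 0, 0, 1]]
     else if d = 2 then
       [[2, 0, 0, 0],
        [0, 0, 0, 0],
        [0, 0, 0, 0],
        [0, 0, 0, 2]]
     else if d = 3 then
       [[1, 0, 0, 2],
        [0, 1, 0, 0],
        [0, 0, 1, 0],
        [2, 0, 0, 1]]
     else
       [[2, 0, 0, 2],
        [0, 0, 0, 0],
        [0, 0, 0, 0],
        [2, 0, 0, 2]])"

definition A_C4 :: "nat \<Rightarrow> complex list list" where
  "A_C4 d =
    (if d = 1 then
       [[1, 0, 0, 0],
        [0, 1, 0, 0],
        [0, 0, 1, 0],
        [0, 0, 0, 1]]
     else if d = 2 then
       [[1, 1, 0, 0],
        [1, 1, 0, 0],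
        [0, 0, 1, 1],
        [0, 0, 1, 1]]
     else if d = 3 then
       [[1, 0, 1, 1],
        [0, 1, 1, 1],
        [1, 1, 1, 0],
        [1, 1, 0, 1]]
     else
       [[1, 1, 1, 1],
        [1, 1, 1, 1],
        [1, 1, 1, 1],
        [1, 1, 1, 1]])"

definition graph_M2 :: "nat \<Rightarrow> (nat \<times> nat) qgraph" where
  "graph_M2 d = star_alg.extend (mat_alg {..<2}) (qgraph.fields tau_M2 (op_M2 (A_M2 d)))"

definition graph_C4 :: "nat \<Rightarrow> nat qgraph" where
  "graph_C4 d = star_alg.extend (diag_alg {..<4}) (qgraph.fields tau_C4 (op_C4 (A_C4 d)))"

end

theory Submission imports Defs "HOL-Analysis.L2_Norm" begin

text \<open>
  The four Pauli unitaries \<open>U\<^sub>0 = 1\<close>, \<open>U\<^sub>1 = Z\<close>, \<open>U\<^sub>2 = X\<close>, \<open>U\<^sub>3 = XZ\<close>, indexed by the group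
  \<open>\<Gamma> = \<int>\<^sub>2 \<times> \<int>\<^sub>2\<close>, form an orthogonal basis of \<open>M\<^sub>2\<close> for the trace and a projective representation of
  \<open>\<Gamma>\<close>. Let \<open>\<pi>\<^sub>k(b) = U\<^sub>k b U\<^sub>k\<^sup>*\<close>. Each adjacency operator on \<open>M\<^sub>2\<close> is a sum of these conjugations,
  \<open>A\<^sub>d = \<Sum>\<^bsub>s\<in>S\<^sub>d\<^esub> \<pi>\<^sub>s\<close>, and the matrix \<open>A'\<^sub>d\<close> is the adjacency matrix of the Cayley graph of \<open>\<Gamma>\<close> with the same
  connection set \<open>S\<^sub>d\<close> (\<open>op_M2_twirl\<close>, \<open>op_C4_xor\<close>).

  The quantum isomorphism lives on \<open>H = \<complex>\<^sup>2\<close> and is \<open>P(b \<otimes> h) = \<Sum>\<^sub>k \<pi>\<^sub>k(b) h \<otimes> e\<^sub>k\<close>. Its requirements become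
  properties of the family \<open>\<pi>\<close>. Every \<open>\<pi>\<^sub>k\<close> is a unital *-automorphism, which gives the homomorphism
  condition. The average of the \<open>\<pi>\<^sub>k(b)\<close> is \<open>\<tau>(b) 1\<close>, which gives compatibility with the states
  (\<open>twirl_average\<close>). The identity \<open>m (\<pi>\<^sub>k \<otimes> \<pi>\<^sub>l) m\<^sup>\<dagger> = 4 \<delta>\<^sub>k\<^sub>l \<pi>\<^sub>k\<close> (\<open>twirl_orthogonality\<close>), a form of the trace
  orthogonality of the \<open>U\<^sub>k\<close>, gives compatibility with the comultiplications and also
  shows that \<open>A\<^sub>d\<close> is Schur idempotent. Finally \<open>\<pi>\<^sub>k \<pi>\<^sub>s = \<pi>\<^bsub>k+s\<^esub>\<close> (\<open>twirl_twirl\<close>) makes \<open>P\<close> intertwine the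
  two adjacency operators, since \<open>A'\<^sub>d\<close> is a sum of translations.

  What remains is that both algebras carry the structure of a quantum graph. In each of them the
  coordinate basis is orthogonal with all norms equal, and from this the theory of
  \<open>orthogonal_basis\<close> yields faithfulness of the state, a C*-norm (the operator norm of left
  multiplication) and a coordinate formula for \<open>m\<^sup>\<dagger>\<close>.
\<close>

section \<open>Linear maps and functionals in coordinates\<close>

lemma cspace_sum:
  assumes "\<And>s. s \<in> S \<Longrightarrow> X s \<in> cspace I"
  shows "(\<lambda>i. \<Sum>s\<in>S. a s * X s i) \<in> cspace I"
  using assms by (auto simp: cspace_def)

lemma cspace_scale: "x \<in> cspace I \<Longrightarrow> (\<lambda>i. c * x i) \<in> cspace I"
  by (auto simp: cspace_def)

lemma bvec_cspace [simp]: "bvec i \<in> cspace I \<longleftrightarrow> i \<in> I"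
  by (auto simp: cspace_def bvec_def)

lemma zero_cspace [simp]: "(\<lambda>i. 0) \<in> cspace I"
  by (simp add: cspace_def)

lemma cspace_expand:
  assumes "finite I" "x \<in> cspace I"
  shows "x = (\<lambda>k. \<Sum>i\<in>I. x i * bvec i k)"
proof
  fix k
  have "(\<Sum>i\<in>I. x i * bvec i k) = (\<Sum>i\<in>I. if k = i then x i else 0)"
    by (rule sum.cong) (auto simp: bvec_def)
  then show "x k = (\<Sum>i\<in>I. x i * bvec i k)"
    using assms by (auto simp: cspace_def)
qed

lemma linear_op_mem: "linear_op I J T \<Longrightarrow> x \<in> cspace I \<Longrightarrow> T x \<in> cspace J"
  by (simp add: linear_op_def)

lemma linear_op_add:
  "linear_op I J T \<Longrightarrow> x \<in> cspace I \<Longrightarrow> y \<in> cspace I \<Longrightarrow> T (\<lambda>i. x i + y i) = (\<lambda>j. T x j + T y j)"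
  by (simp add: linear_op_def)

lemma linear_op_scale:
  "linear_op I J T \<Longrightarrow> x \<in> cspace I \<Longrightarrow> T (\<lambda>i. c * x i) = (\<lambda>j. c * T x j)"
  by (simp add: linear_op_def)

lemma linear_op_sum:
  assumes "linear_op I J T" "finite S" "\<And>s. s \<in> S \<Longrightarrow> X s \<in> cspace I"
  shows "T (\<lambda>i. \<Sum>s\<in>S. a s * X s i) = (\<lambda>j. \<Sum>s\<in>S. a s * T (X s) j)"
  using assms(2,3)
proof (induction S rule: finite_induct)
  case empty
  have "T (\<lambda>i. 0 * (0::complex)) = (\<lambda>j. 0 * T (\<lambda>i. 0) j)"
    using linear_op_scale[OF assms(1), of "\<lambda>i. 0" 0] by simp
  then show ?case by simp
next
  case (insert s S)
  have m: "(\<lambda>i. a s * X s i) \<in> cspace I" "(\<lambda>i. \<Sum>s\<in>S. a s * X s i) \<in> cspace I"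
    using insert.prems by (auto intro!: cspace_sum cspace_scale)
  have "T (\<lambda>i. a s * X s i + (\<Sum>s\<in>S. a s * X s i))
      = (\<lambda>j. a s * T (X s) j + (\<Sum>s\<in>S. a s * T (X s) j))"
    using linear_op_add[OF assms(1) m] linear_op_scale[OF assms(1), of "X s" "a s"] insert by simp
  then show ?case using insert.hyps by simp
qed

lemma linear_op_expand:
  assumes "linear_op I J T" "finite I" "x \<in> cspace I"
  shows "T x = (\<lambda>j. \<Sum>i\<in>I. x i * T (bvec i) j)"
  using linear_op_sum[OF assms(1,2), of bvec x] cspace_expand[OF assms(2,3)] by simp

lemma functional_linear_op:
  "linear_functional I f \<longleftrightarrow> linear_op I (UNIV :: unit set) (\<lambda>x _. f x)"
  by (simp add: linear_functional_def linear_op_def cspace_def fun_eq_iff)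

lemma functional_sum:
  assumes "linear_functional I f" "finite S" "\<And>s. s \<in> S \<Longrightarrow> X s \<in> cspace I"
  shows "f (\<lambda>i. \<Sum>s\<in>S. a s * X s i) = (\<Sum>s\<in>S. a s * f (X s))"
  using linear_op_sum[OF assms(1)[unfolded functional_linear_op] assms(2), of X a] assms(3)
  by (simp add: fun_eq_iff)

lemma functional_expand:
  assumes "linear_functional I f" "finite I" "x \<in> cspace I"
  shows "f x = (\<Sum>i\<in>I. x i * f (bvec i))"
  using functional_sum[OF assms(1,2), of bvec x] cspace_expand[OF assms(2,3)] by simp

section \<open>Inner products\<close>

lemma star_algebra_rules:
  assumes "star_algebra B"
  shows star_algebra_finite: "finite (idx B)"
    and star_algebra_unt: "unt B \<in> carr B"
    and star_algebra_mul_right: "x \<in> carr B \<Longrightarrow> linear_op (idx B) (idx B) (mul B x)"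
    and star_algebra_mul_left: "x \<in> carr B \<Longrightarrow> linear_op (idx B) (idx B) (\<lambda>y. mul B y x)"
    and star_algebra_assoc: "x \<in> carr B \<Longrightarrow> y \<in> carr B \<Longrightarrow> z \<in> carr B \<Longrightarrow>
           mul B (mul B x y) z = mul B x (mul B y z)"
    and star_algebra_unit: "x \<in> carr B \<Longrightarrow> mul B (unt B) x = x" "x \<in> carr B \<Longrightarrow> mul B x (unt B) = x"
    and star_algebra_star: "x \<in> carr B \<Longrightarrow> star B x \<in> carr B" "x \<in> carr B \<Longrightarrow> star B (star B x) = x"
    and star_algebra_star_add: "x \<in> carr B \<Longrightarrow> y \<in> carr B \<Longrightarrow>
           star B (\<lambda>i. x i + y i) = (\<lambda>i. star B x i + star B y i)"
    and star_algebra_star_scale: "x \<in> carr B \<Longrightarrow> star B (\<lambda>i. c * x i) = (\<lambda>i. cnj c * star B x i)"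
    and star_algebra_star_mul: "x \<in> carr B \<Longrightarrow> y \<in> carr B \<Longrightarrow>
           star B (mul B x y) = mul B (star B y) (star B x)"
  using assms unfolding star_algebra_def by blast+

lemma star_algebra_mul_mem:
  "star_algebra B \<Longrightarrow> x \<in> carr B \<Longrightarrow> y \<in> carr B \<Longrightarrow> mul B x y \<in> carr B"
  using linear_op_mem star_algebra_mul_right by blast

text \<open>For a fixed right argument the conjugate of the inner product is a linear functional of the left
  argument, so the expansion of functionals in a basis applies to both arguments.\<close>

lemma inner_of_expand:
  assumes B: "star_algebra B" and f: "linear_functional (idx B) \<phi>"
    and x: "x \<in> carr B" and y: "y \<in> carr B"
  shows "inner_of B \<phi> x y =
    (\<Sum>i\<in>idx B. \<Sum>k\<in>idx B. cnj (x i) * y k * inner_of B \<phi> (bvec i) (bvec k))"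
proof -
  note [simp] = star_algebra_star[OF B] star_algebra_mul_mem[OF B]
  have fin: "finite (idx B)" by (rule star_algebra_finite[OF B])
  have right: "linear_functional (idx B) (inner_of B \<phi> u)" if "u \<in> carr B" for u
    using f that linear_op_add[OF star_algebra_mul_right[OF B, of "star B u"]]
      linear_op_scale[OF star_algebra_mul_right[OF B, of "star B u"]]
    by (simp add: linear_functional_def inner_of_def)
  have left: "linear_functional (idx B) (\<lambda>u. cnj (inner_of B \<phi> u v))" if "v \<in> carr B" for v
    using f that linear_op_add[OF star_algebra_mul_left[OF B, of v]]
      linear_op_scale[OF star_algebra_mul_left[OF B, of v]]
    by (simp add: linear_functional_def inner_of_def star_algebra_star_add[OF B]
        star_algebra_star_scale[OF B])
  have "inner_of B \<phi> x y = (\<Sum>k\<in>idx B. y k * inner_of B \<phi> x (bvec k))"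
    by (rule functional_expand[OF right[OF x] fin y])
  also have "\<dots> = (\<Sum>k\<in>idx B. y k * (\<Sum>i\<in>idx B. cnj (x i) * inner_of B \<phi> (bvec i) (bvec k)))"
  proof (rule sum.cong[OF refl])
    fix k assume "k \<in> idx B"
    then have "cnj (inner_of B \<phi> x (bvec k)) = (\<Sum>i\<in>idx B. x i * cnj (inner_of B \<phi> (bvec i) (bvec k)))"
      using functional_expand[OF left fin x, of "bvec k"] by simp
    then have "cnj (cnj (inner_of B \<phi> x (bvec k))) =
        cnj (\<Sum>i\<in>idx B. x i * cnj (inner_of B \<phi> (bvec i) (bvec k)))" by (rule arg_cong)
    then show "y k * inner_of B \<phi> x (bvec k)
        = y k * (\<Sum>i\<in>idx B. cnj (x i) * inner_of B \<phi> (bvec i) (bvec k))" by simp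
  qed
  finally show ?thesis
    by (subst sum.swap) (simp add: sum_distrib_left mult_ac)
qed

lemma state_tensor_sum:
  assumes "linear_functional I \<phi>" "linear_functional J \<psi>" "finite S"
    and "\<And>s. s \<in> S \<Longrightarrow> X s \<in> cspace I" "\<And>s. s \<in> S \<Longrightarrow> Y s \<in> cspace J"
  shows "state_tensor \<phi> \<psi> (\<lambda>p. \<Sum>s\<in>S. a s * tens (X s) (Y s) p) = (\<Sum>s\<in>S. a s * \<phi> (X s) * \<psi> (Y s))"
proof -
  have "\<psi> (\<lambda>j. \<Sum>s\<in>S. a s * (X s i * Y s j)) = (\<Sum>s\<in>S. (a s * \<psi> (Y s)) * X s i)" for i
    using functional_sum[OF assms(2,3), of Y "\<lambda>s. a s * X s i"] assms(5) by (simp add: mult_ac)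
  then show ?thesis
    using functional_sum[OF assms(1,3), of X "\<lambda>s. a s * \<psi> (Y s)"] assms(4)
    by (simp add: state_tensor_def id_fun_def tens_def mult_ac)
qed

lemma inner_of_expand_star:
  assumes B: "star_algebra B" and f: "linear_functional (idx B) \<phi>"
    and x: "x \<in> carr B" and y: "y \<in> carr B"
  shows "inner_of B \<phi> x y = (\<Sum>i\<in>idx B. star B x i * \<phi> (mul B (bvec i) y))"
proof -
  have "mul B (star B x) y = (\<lambda>j. \<Sum>i\<in>idx B. star B x i * mul B (bvec i) y j)"
    by (rule linear_op_expand[OF star_algebra_mul_left[OF B y]])
      (simp_all add: star_algebra_finite[OF B] star_algebra_star[OF B] x)
  then show ?thesis
    unfolding inner_of_def
    by (simp add: functional_sum[OF f star_algebra_finite[OF B]] star_algebra_mul_mem[OF B] y)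
qed

text \<open>The Hilbert space tensor product has \<open>\<langle>a \<otimes> b | c \<otimes> d\<rangle> = \<langle>a | c\<rangle> \<langle>b | d\<rangle>\<close>. The sums that define the
  product and the involution of the tensor algebra collapse to this once the sum over the
  coordinates of \<open>e\<^sub>p\<^sup>*\<close> is carried out first, in each factor separately.\<close>

lemma inner_of_tensor:
  assumes B: "star_algebra B" and f: "linear_functional (idx B) \<phi>"
    and C: "star_algebra C" and g: "linear_functional (idx C) \<psi>"
  shows "inner_of (tensor_alg B C) (state_tensor \<phi> \<psi>) w z =
    (\<Sum>p\<in>idx B \<times> idx C. \<Sum>q\<in>idx B \<times> idx C. cnj (w p) * z q *
      (inner_of B \<phi> (bvec (fst p)) (bvec (fst q)) * inner_of C \<psi> (bvec (snd p)) (bvec (snd q))))"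
proof -
  let ?I = "idx B" and ?J = "idx C"
  let ?S = "?I \<times> ?J"
  have fin: "finite ?I" "finite ?J" by (auto intro: star_algebra_finite B C)
  define u where "u = star (tensor_alg B C) w"
  have u: "u r = (\<Sum>p\<in>?S. cnj (w p) * (star B (bvec (fst p)) (fst r) * star C (bvec (snd p)) (snd r)))" for r
    by (simp add: u_def tensor_alg_def tens_def case_prod_unfold)
  define f' where "f' i k = \<phi> (mul B (bvec i) (bvec k))" for i k
  define g' where "g' i k = \<psi> (mul C (bvec i) (bvec k))" for i k
  have "inner_of (tensor_alg B C) (state_tensor \<phi> \<psi>) w z
      = state_tensor \<phi> \<psi> (\<lambda>pq. \<Sum>s\<in>?S \<times> ?S. (u (fst s) * z (snd s)) *
          tens (mul B (bvec (fst (fst s))) (bvec (fst (snd s))))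
            (mul C (bvec (snd (fst s))) (bvec (snd (snd s)))) pq)"
    by (simp add: inner_of_def u_def[symmetric] sum.cartesian_product)
      (simp add: tensor_alg_def case_prod_unfold sum.cartesian_product)
  also have "\<dots> = (\<Sum>s\<in>?S \<times> ?S. (u (fst s) * z (snd s)) *
      \<phi> (mul B (bvec (fst (fst s))) (bvec (fst (snd s)))) *
      \<psi> (mul C (bvec (snd (fst s))) (bvec (snd (snd s)))))"
    by (rule state_tensor_sum[OF f g])
      (auto simp: fin intro!: star_algebra_mul_mem B C)
  also have "\<dots> = (\<Sum>r\<in>?S. \<Sum>q\<in>?S. u r * z q * f' (fst r) (fst q) * g' (snd r) (snd q))"
    by (simp add: sum.cartesian_product case_prod_unfold f'_def g'_def)
  also have "\<dots> = (\<Sum>r\<in>?S. \<Sum>q\<in>?S. \<Sum>p\<in>?S. cnj (w p) * z q *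
      ((star B (bvec (fst p)) (fst r) * f' (fst r) (fst q)) *
       (star C (bvec (snd p)) (snd r) * g' (snd r) (snd q))))"
    unfolding u by (simp add: sum_distrib_left sum_distrib_right mult_ac)
  also have "\<dots> = (\<Sum>p\<in>?S. \<Sum>q\<in>?S. \<Sum>r\<in>?S. cnj (w p) * z q *
      ((star B (bvec (fst p)) (fst r) * f' (fst r) (fst q)) *
       (star C (bvec (snd p)) (snd r) * g' (snd r) (snd q))))"
    by (subst sum.swap, subst (2) sum.swap, subst sum.swap, rule refl)
  also have "\<dots> = (\<Sum>p\<in>?S. \<Sum>q\<in>?S. cnj (w p) * z q *
      (inner_of B \<phi> (bvec (fst p)) (bvec (fst q)) * inner_of C \<psi> (bvec (snd p)) (bvec (snd q))))"
  proof (intro sum.cong refl)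
    fix p q assume "p \<in> ?S" "q \<in> ?S"
    then have "inner_of B \<phi> (bvec (fst p)) (bvec (fst q)) * inner_of C \<psi> (bvec (snd p)) (bvec (snd q))
      = (\<Sum>i\<in>?I. \<Sum>j\<in>?J. (star B (bvec (fst p)) i * f' i (fst q)) * (star C (bvec (snd p)) j * g' j (snd q)))"
      by (auto simp: inner_of_expand_star[OF B f] inner_of_expand_star[OF C g] f'_def g'_def sum_product)
    then show "(\<Sum>r\<in>?S. cnj (w p) * z q *
      ((star B (bvec (fst p)) (fst r) * f' (fst r) (fst q)) *
       (star C (bvec (snd p)) (snd r) * g' (snd r) (snd q)))) = cnj (w p) * z q *
      (inner_of B \<phi> (bvec (fst p)) (bvec (fst q)) * inner_of C \<psi> (bvec (snd p)) (bvec (snd q)))"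
      by (simp add: sum.cartesian_product case_prod_unfold sum_distrib_left)
  qed
  finally show ?thesis .
qed

section \<open>Orthogonal bases of equal norm\<close>

text \<open>Matrix units for the normalised trace, and the minimal projections of \<open>\<complex>\<^sup>4\<close> for the uniform state,
  are orthogonal and all have the same squared norm \<open>c\<close>. That makes the state faithful,
  produces a C*-norm, and gives the adjoint of the multiplication in coordinates.\<close>

locale orthogonal_basis =
  fixes G :: "('i, 'm) qgraph_scheme" and c :: real
  assumes star_algebra: "star_algebra G"
    and linear_state: "linear_functional (idx G) (state G)"
    and unital_state: "state G (unt G) = 1"
    and pos: "c > 0"
    and orthogonal: "i \<in> idx G \<Longrightarrow> k \<in> idx G \<Longrightarrow>
      inner_of G (state G) (bvec i) (bvec k) = (if i = k then of_real c else 0)"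
begin

lemma finite_idx [simp]: "finite (idx G)"
  by (rule star_algebra_finite[OF star_algebra])

lemma inner_eq:
  assumes "x \<in> carr G" "y \<in> carr G"
  shows "inner_of G (state G) x y = of_real c * (\<Sum>i\<in>idx G. cnj (x i) * y i)"
proof -
  have "inner_of G (state G) x y
      = (\<Sum>i\<in>idx G. \<Sum>k\<in>idx G. if i = k then of_real c * (cnj (x i) * y k) else 0)"
    unfolding inner_of_expand[OF star_algebra linear_state assms]
    by (intro sum.cong refl) (auto simp: orthogonal)
  also have "\<dots> = (\<Sum>i\<in>idx G. of_real c * (cnj (x i) * y i))"
    by (intro sum.cong refl) (simp add: sum.delta)
  finally show ?thesis by (simp add: sum_distrib_left)
qed

text \<open>The factor \<open>c\<close> is left out: it cancels in operator norms.\<close>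

definition vnorm :: "('i \<Rightarrow> complex) \<Rightarrow> real" where
  "vnorm x = L2_set (\<lambda>i. cmod (x i)) (idx G)"

lemma vnorm_nonneg [simp]: "0 \<le> vnorm x"
  by (simp add: vnorm_def L2_set_nonneg)

lemma vnorm_eq_0: "x \<in> carr G \<Longrightarrow> vnorm x = 0 \<longleftrightarrow> x = (\<lambda>i. 0)"
  unfolding vnorm_def by (subst L2_set_eq_0_iff) (auto simp: cspace_def fun_eq_iff)

lemma vnorm_scale: "vnorm (\<lambda>i. a * x i) = cmod a * vnorm x"
  by (simp add: vnorm_def norm_mult L2_set_right_distrib)

lemma vnorm_add: "vnorm (\<lambda>i. x i + y i) \<le> vnorm x + vnorm y"
proof -
  have "vnorm (\<lambda>i. x i + y i) \<le> L2_set (\<lambda>i. cmod (x i) + cmod (y i)) (idx G)"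
    unfolding vnorm_def by (intro L2_set_mono norm_triangle_ineq) simp
  then show ?thesis using L2_set_triangle_ineq[of "\<lambda>i. cmod (x i)" "\<lambda>i. cmod (y i)" "idx G"]
    by (simp add: vnorm_def)
qed

lemma vnorm_sum: "finite S \<Longrightarrow> vnorm (\<lambda>i. \<Sum>s\<in>S. X s i) \<le> (\<Sum>s\<in>S. vnorm (X s))"
proof (induction S rule: finite_induct)
  case empty
  then show ?case by (simp add: vnorm_def L2_set_def)
next
  case (insert s S)
  then show ?case using vnorm_add[of "X s" "\<lambda>i. \<Sum>s\<in>S. X s i"] by simp
qed

lemma vnorm_inner:
  assumes "x \<in> carr G"
  shows "inner_of G (state G) x x = of_real (c * (vnorm x)\<^sup>2)"
proof -
  have "of_real ((vnorm x)\<^sup>2) = (\<Sum>i\<in>idx G. cnj (x i) * x i)"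
    by (simp add: vnorm_def L2_set_def sum_nonneg mult.commute flip: complex_norm_square)
  then show ?thesis using assms by (simp only: inner_eq of_real_mult)
qed

lemma Cauchy_Schwarz:
  assumes "x \<in> carr G" "y \<in> carr G"
  shows "cmod (inner_of G (state G) x y) \<le> c * (vnorm x * vnorm y)"
proof -
  have "cmod (\<Sum>i\<in>idx G. cnj (x i) * y i) \<le> (\<Sum>i\<in>idx G. \<bar>cmod (x i)\<bar> * \<bar>cmod (y i)\<bar>)"
    by (rule order_trans[OF norm_sum]) (simp add: norm_mult)
  also have "\<dots> \<le> vnorm x * vnorm y"
    unfolding vnorm_def by (rule L2_set_mult_ineq)
  finally show ?thesis
    using pos assms by (simp add: inner_eq norm_mult)
qed

lemma faithful: "faithful_state G (state G)"
proof -
  have "state G (mul G (star G x) x) = of_real (c * (vnorm x)\<^sup>2)" if "x \<in> carr G" for x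
    using vnorm_inner[OF that] by (simp add: inner_of_def)
  then show ?thesis
    using pos by (auto simp: faithful_state_def linear_state unital_state vnorm_eq_0)
qed

text \<open>The operator norm of \<open>a\<close> in the GNS representation, that is, acting by left multiplication on
  \<open>L\<^sup>2(B, \<psi>)\<close>. The infimum is over all admissible constants, so that
  every admissible constant bounds it from above directly.\<close>

definition left_norm :: "('i \<Rightarrow> complex) \<Rightarrow> real" where
  "left_norm a = Inf {C. 0 \<le> C \<and> (\<forall>x\<in>carr G. vnorm (mul G a x) \<le> C * vnorm x)}"

lemma left_norm_least:
  "0 \<le> C \<Longrightarrow> (\<And>x. x \<in> carr G \<Longrightarrow> vnorm (mul G a x) \<le> C * vnorm x) \<Longrightarrow> left_norm a \<le> C"
  unfolding left_norm_def by (rule cInf_lower) (auto intro: bdd_belowI[of _ 0])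

lemma left_mult_bounded:
  assumes "a \<in> carr G"
  shows "\<exists>C\<ge>0. \<forall>x\<in>carr G. vnorm (mul G a x) \<le> C * vnorm x"
proof (intro exI conjI ballI)
  let ?C = "\<Sum>i\<in>idx G. vnorm (mul G a (bvec i))"
  show "0 \<le> ?C" by (simp add: sum_nonneg)
  fix x assume x: "x \<in> carr G"
  have "vnorm (mul G a x) = vnorm (\<lambda>j. \<Sum>i\<in>idx G. x i * mul G a (bvec i) j)"
    by (subst linear_op_expand[OF star_algebra_mul_right[OF star_algebra assms]]) (simp_all add: x)
  also have "\<dots> \<le> (\<Sum>i\<in>idx G. cmod (x i) * vnorm (mul G a (bvec i)))"
    using vnorm_sum[of "idx G" "\<lambda>i j. x i * mul G a (bvec i) j"] by (simp add: vnorm_scale)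
  also have "\<dots> \<le> (\<Sum>i\<in>idx G. vnorm x * vnorm (mul G a (bvec i)))"
    unfolding vnorm_def[of x]
    by (intro sum_mono mult_right_mono vnorm_nonneg member_le_L2_set finite_idx)
  finally show "vnorm (mul G a x) \<le> ?C * vnorm x"
    by (simp add: sum_distrib_left mult.commute)
qed

lemma left_norm_nonneg: "a \<in> carr G \<Longrightarrow> 0 \<le> left_norm a"
  unfolding left_norm_def using left_mult_bounded by (intro cInf_greatest) auto

lemma left_norm_bound:
  assumes a: "a \<in> carr G" and x: "x \<in> carr G"
  shows "vnorm (mul G a x) \<le> left_norm a * vnorm x"
proof (cases "vnorm x = 0")
  case True
  then show ?thesis using left_mult_bounded[OF a] x by fastforce
next
  case False
  then have p: "vnorm x > 0" by (simp add: order_less_le)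
  have "vnorm (mul G a x) / vnorm x \<le> left_norm a"
    unfolding left_norm_def using left_mult_bounded[OF a] x p
    by (intro cInf_greatest) (auto simp: divide_le_eq)
  then show ?thesis using p by (simp add: divide_le_eq)
qed

lemma left_norm_mul:
  assumes "a \<in> carr G" "b \<in> carr G"
  shows "left_norm (mul G a b) \<le> left_norm a * left_norm b"
proof (rule left_norm_least)
  show "0 \<le> left_norm a * left_norm b" by (simp add: left_norm_nonneg assms)
  fix x assume x: "x \<in> carr G"
  have "vnorm (mul G a (mul G b x)) \<le> left_norm a * vnorm (mul G b x)"
    by (intro left_norm_bound assms star_algebra_mul_mem star_algebra x)
  also have "\<dots> \<le> left_norm a * (left_norm b * vnorm x)"
    by (intro mult_left_mono left_norm_bound left_norm_nonneg assms x)
  finally show "vnorm (mul G (mul G a b) x) \<le> left_norm a * left_norm b * vnorm x"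
    by (simp add: star_algebra_assoc[OF star_algebra] assms x mult_ac)
qed

text \<open>The adjoint of left multiplication by \<open>a\<close> is left multiplication by \<open>a\<^sup>*\<close>, whence
  \<open>\<parallel>ax\<parallel>\<^sup>2 = \<langle>x | a\<^sup>*a x\<rangle> \<le> \<parallel>a\<^sup>*a\<parallel> \<parallel>x\<parallel>\<^sup>2\<close>.\<close>

lemma left_norm_square_le:
  assumes a: "a \<in> carr G"
  shows "(left_norm a)\<^sup>2 \<le> left_norm (mul G (star G a) a)"
proof -
  let ?b = "mul G (star G a) a"
  note mem = star_algebra_mul_mem[OF star_algebra] star_algebra_star[OF star_algebra]
  have nn: "0 \<le> left_norm ?b" by (simp add: left_norm_nonneg mem a)
  have "left_norm a \<le> sqrt (left_norm ?b)"
  proof (rule left_norm_least)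
    fix x assume x: "x \<in> carr G"
    have "inner_of G (state G) (mul G a x) (mul G a x) = inner_of G (state G) x (mul G ?b x)"
      by (simp add: inner_of_def star_algebra_star_mul[OF star_algebra]
          star_algebra_assoc[OF star_algebra] mem a x)
    then have "inner_of G (state G) x (mul G ?b x) = of_real (c * (vnorm (mul G a x))\<^sup>2)"
      using vnorm_inner[of "mul G a x"] by (simp add: mem a x)
    then have "c * (vnorm (mul G a x))\<^sup>2 = cmod (inner_of G (state G) x (mul G ?b x))"
      using pos by (simp only: norm_of_real) simp
    also have "\<dots> \<le> c * (vnorm x * vnorm (mul G ?b x))"
      by (intro Cauchy_Schwarz mem a x)
    also have "\<dots> \<le> c * (vnorm x * (left_norm ?b * vnorm x))"
      using pos by (intro mult_left_mono left_norm_bound mem a x) auto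
    finally have "(vnorm (mul G a x))\<^sup>2 \<le> left_norm ?b * (vnorm x)\<^sup>2"
      using pos by (simp add: power2_eq_square mult_ac)
    then have "vnorm (mul G a x) \<le> sqrt (left_norm ?b * (vnorm x)\<^sup>2)"
      by (rule real_le_rsqrt)
    then show "vnorm (mul G a x) \<le> sqrt (left_norm ?b) * vnorm x"
      by (simp add: real_sqrt_mult)
  qed (simp add: nn)
  then have "(left_norm a)\<^sup>2 \<le> (sqrt (left_norm ?b))\<^sup>2"
    by (rule power_mono) (simp add: left_norm_nonneg a)
  then show ?thesis using nn by simp
qed

lemma left_norm_star_le:
  assumes a: "a \<in> carr G"
  shows "left_norm a \<le> left_norm (star G a)"
proof -
  have "left_norm a * left_norm a \<le> left_norm (star G a) * left_norm a"
    using left_norm_square_le[OF a] left_norm_mul[of "star G a" a] a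
    by (simp add: power2_eq_square star_algebra_star[OF star_algebra])
  then show ?thesis
    using left_norm_nonneg[OF a] left_norm_nonneg[of "star G a"] a
    by (cases "left_norm a = 0") (auto simp: star_algebra_star[OF star_algebra])
qed

text \<open>Definiteness is tested on the unit vector \<open>1\<close>, since \<open>a = a 1\<close>. The C*-identity combines
  \<open>\<parallel>a\<parallel>\<^sup>2 \<le> \<parallel>a\<^sup>*a\<parallel> \<le> \<parallel>a\<^sup>*\<parallel> \<parallel>a\<parallel>\<close> with the resulting equality of \<open>\<parallel>a\<^sup>*\<parallel>\<close> and \<open>\<parallel>a\<parallel>\<close>.\<close>

lemma cstar_norm_left_norm: "cstar_norm G left_norm"
proof -
  note mem = star_algebra_mul_mem[OF star_algebra] star_algebra_star[OF star_algebra]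
  have mul_add: "mul G (\<lambda>i. a i + b i) x = (\<lambda>i. mul G a x i + mul G b x i)"
    if "a \<in> carr G" "b \<in> carr G" "x \<in> carr G" for a b x
    using linear_op_add[OF star_algebra_mul_left[OF star_algebra]] that by auto
  have mul_scale: "mul G (\<lambda>i. k * a i) x = (\<lambda>i. k * mul G a x i)"
    if "a \<in> carr G" "x \<in> carr G" for a x k
    using linear_op_scale[OF star_algebra_mul_left[OF star_algebra]] that by auto
  have zero: "left_norm a = 0 \<longleftrightarrow> a = (\<lambda>i. 0)" if a: "a \<in> carr G" for a
  proof
    assume "left_norm a = 0"
    then have "vnorm (mul G a (unt G)) \<le> 0"
      using left_norm_bound[OF a star_algebra_unt[OF star_algebra]] by simp
    then show "a = (\<lambda>i. 0)"
      using a vnorm_nonneg[of a] by (simp add: star_algebra_unit[OF star_algebra] flip: vnorm_eq_0)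
  next
    assume "a = (\<lambda>i. 0)"
    then have "left_norm a \<le> 0"
      using mul_scale[of a _ 0] a
      by (intro left_norm_least) (auto simp: vnorm_def L2_set_def)
    then show "left_norm a = 0" using left_norm_nonneg[OF a] by simp
  qed
  have add: "left_norm (\<lambda>i. a i + b i) \<le> left_norm a + left_norm b"
    if a: "a \<in> carr G" and b: "b \<in> carr G" for a b
  proof (rule left_norm_least)
    show "0 \<le> left_norm a + left_norm b" by (simp add: left_norm_nonneg a b)
    fix x assume x: "x \<in> carr G"
    show "vnorm (mul G (\<lambda>i. a i + b i) x) \<le> (left_norm a + left_norm b) * vnorm x"
      using vnorm_add[of "mul G a x" "mul G b x"] left_norm_bound[OF a x] left_norm_bound[OF b x]
      by (simp add: mul_add a b x distrib_right)
  qed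
  have scale_le: "left_norm (\<lambda>i. k * a i) \<le> cmod k * left_norm a" if a: "a \<in> carr G" for a k
    using left_norm_bound[OF a]
    by (intro left_norm_least)
      (auto simp: left_norm_nonneg a mul_scale vnorm_scale mult.assoc intro!: mult_left_mono)
  have scale: "left_norm (\<lambda>i. k * a i) = cmod k * left_norm a" if a: "a \<in> carr G" for a k
  proof (cases "k = 0")
    case True
    then show ?thesis by (simp add: zero)
  next
    case False
    then have "left_norm a \<le> cmod (inverse k) * left_norm (\<lambda>i. k * a i)"
      using scale_le[of "\<lambda>i. k * a i" "inverse k"] cspace_scale[OF a, of k] by (simp flip: mult.assoc)
    then show ?thesis
      using scale_le[OF a, of k] False by (simp add: norm_inverse norm_divide field_simps)
  qed
  have cstar: "left_norm (mul G (star G a) a) = (left_norm a)\<^sup>2" if a: "a \<in> carr G" for a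
  proof (rule antisym)
    have "left_norm (star G a) \<le> left_norm a"
      using left_norm_star_le[of "star G a"] by (simp add: mem a)
    then have "left_norm (star G a) * left_norm a \<le> left_norm a * left_norm a"
      by (intro mult_right_mono left_norm_nonneg a)
    then show "left_norm (mul G (star G a) a) \<le> (left_norm a)\<^sup>2"
      using left_norm_mul[of "star G a" a] by (simp add: mem a power2_eq_square)
  qed (rule left_norm_square_le[OF a])
  show ?thesis
    by (auto simp: cstar_norm_def zero add scale cstar left_norm_mul left_norm_nonneg)
qed

lemma fd_cstar: "fd_cstar_algebra G"
  using star_algebra cstar_norm_left_norm by (auto simp: fd_cstar_algebra_def)

lemma inner_tensor_eq:
  "inner_of (tensor_alg G G) (state_tensor (state G) (state G)) w z
    = of_real (c\<^sup>2) * (\<Sum>p\<in>idx G \<times> idx G. cnj (w p) * z p)"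
proof -
  have "inner_of (tensor_alg G G) (state_tensor (state G) (state G)) w z
      = (\<Sum>p\<in>idx G \<times> idx G. \<Sum>q\<in>idx G \<times> idx G.
          if p = q then of_real (c\<^sup>2) * (cnj (w p) * z q) else 0)"
    unfolding inner_of_tensor[OF star_algebra linear_state star_algebra linear_state]
    by (intro sum.cong refl) (auto simp: orthogonal power2_eq_square prod_eq_iff)
  also have "\<dots> = (\<Sum>p\<in>idx G \<times> idx G. of_real (c\<^sup>2) * (cnj (w p) * z p))"
    by (intro sum.cong refl) simp
  finally show ?thesis by (simp add: sum_distrib_left)
qed

text \<open>Pairing with \<open>e\<^sub>i \<otimes> e\<^sub>j\<close> in the defining property of the adjoint isolates the coordinate \<open>(i, j)\<close>,
  scaled by \<open>c\<^sup>2\<close> on the tensor side and by \<open>c\<close> on the other side; this leaves the factor \<open>1 / c\<close> and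
  also shows that the adjoint is unique.\<close>

lemma comult_eq:
  assumes x: "x \<in> carr G"
  shows "comult G x = (\<lambda>(i, j). if i \<in> idx G \<and> j \<in> idx G
    then (\<Sum>k\<in>idx G. x k * cnj (mul G (bvec i) (bvec j) k)) / of_real c else 0)"
    (is "_ = ?v")
proof -
  let ?S = "idx G \<times> idx G"
  let ?ip = "inner_of (tensor_alg G G) (state_tensor (state G) (state G))"
  have v_mem: "?v \<in> cspace ?S" by (auto simp: cspace_def)
  have v: "?ip ?v z = inner_of G (state G) x (mult_map G z)" for z
  proof -
    have m: "mult_map G z \<in> carr G"
      unfolding mult_map_def case_prod_unfold
      by (rule cspace_sum) (auto intro: star_algebra_mul_mem[OF star_algebra])
    have "inner_of G (state G) x (mult_map G z)
      = of_real c * (\<Sum>k\<in>idx G. \<Sum>p\<in>?S. cnj (x k) * (z p * mul G (bvec (fst p)) (bvec (snd p)) k))"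
      unfolding inner_eq[OF x m] unfolding mult_map_def case_prod_unfold by (simp add: sum_distrib_left)
    also have "\<dots> = of_real c * (\<Sum>p\<in>?S. \<Sum>k\<in>idx G. cnj (x k) * (z p * mul G (bvec (fst p)) (bvec (snd p)) k))"
      by (subst sum.swap) (rule refl)
    also have "\<dots> = of_real (c\<^sup>2) * (\<Sum>p\<in>?S. cnj (?v p) * z p)"
      using pos unfolding sum_distrib_left power2_eq_square
      by (intro sum.cong refl)
        (auto simp: sum_distrib_left sum_distrib_right sum_divide_distrib field_simps)
    finally show ?thesis by (simp add: inner_tensor_eq)
  qed
  have unique: "w = ?v" if w: "w \<in> cspace ?S"
    and eq: "\<forall>z\<in>cspace ?S. ?ip w z = inner_of G (state G) x (mult_map G z)" for w
  proof
    fix p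
    \<comment> \<open>Inside the carrier, basis vectors detect coordinates; outside, both sides vanish.\<close>
    show "w p = ?v p"
    proof (cases "p \<in> ?S")
      case True
      have coord: "?ip u (bvec p) = of_real (c\<^sup>2) * cnj (u p)" for u
      proof -
        have "(\<Sum>q\<in>?S. cnj (u q) * bvec p q) = (\<Sum>q\<in>?S. if q = p then cnj (u q) else 0)"
          by (rule sum.cong) (auto simp: bvec_def)
        then show ?thesis using True by (simp add: inner_tensor_eq)
      qed
      have "?ip w (bvec p) = ?ip ?v (bvec p)"
        using bspec[OF eq, of "bvec p"] v[of "bvec p"] True by (simp only: bvec_cspace)
      then show ?thesis using pos unfolding coord by simp
    qed (use w in \<open>cases p; auto simp: cspace_def\<close>)
  qed
  show ?thesis
    unfolding comult_def hilbert_adjoint_def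
    by (rule the_equality) (use v_mem v unique in blast)+
qed

end

lemma bvec_apply: "bvec i k = (if k = i then 1 else 0)"
  by (simp add: bvec_def)

section \<open>Matrix algebras and diagonal algebras\<close>

lemma mat_alg_sel [simp]:
  "idx (mat_alg K) = K \<times> K"
  "mul (mat_alg K) x y (i, j) = (\<Sum>k\<in>K. x (i, k) * y (k, j))"
  "unt (mat_alg K) (i, j) = (if i = j \<and> i \<in> K then 1 else 0)"
  "star (mat_alg K) x (i, j) = cnj (x (j, i))"
  by (simp_all add: mat_alg_def)

lemma diag_alg_sel [simp]:
  "idx (diag_alg K) = K"
  "mul (diag_alg K) x y i = x i * y i"
  "unt (diag_alg K) i = (if i \<in> K then 1 else 0)"
  "star (diag_alg K) x i = cnj (x i)"
  by (simp_all add: diag_alg_def)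

lemma star_algebra_mat_alg:
  assumes K: "finite K"
  shows "star_algebra (mat_alg K)"
proof -
  have assoc: "mul (mat_alg K) (mul (mat_alg K) x y) z = mul (mat_alg K) x (mul (mat_alg K) y z)" for x y z
  proof
    fix p :: "'a \<times> 'a"
    obtain i j where p: "p = (i, j)" by fastforce
    have "(\<Sum>k\<in>K. \<Sum>l\<in>K. x (i, l) * y (l, k) * z (k, j)) = (\<Sum>l\<in>K. \<Sum>k\<in>K. x (i, l) * y (l, k) * z (k, j))"
      by (rule sum.swap)
    then show "mul (mat_alg K) (mul (mat_alg K) x y) z p = mul (mat_alg K) x (mul (mat_alg K) y z) p"
      by (simp add: p sum_distrib_left sum_distrib_right mult.assoc)
  qed
  have unit: "mul (mat_alg K) (unt (mat_alg K)) x = x" "mul (mat_alg K) x (unt (mat_alg K)) = x"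
    if x: "x \<in> carr (mat_alg K)" for x
  proof -
    have "(\<Sum>k\<in>K. (if i = k \<and> i \<in> K then 1 else 0) * x (k, j)) = (\<Sum>k\<in>K. if k = i then x (k, j) else 0)" for i j
      by (rule sum.cong) auto
    then show "mul (mat_alg K) (unt (mat_alg K)) x = x"
      using K x by (auto simp: fun_eq_iff cspace_def)
    have "(\<Sum>k\<in>K. x (i, k) * (if k = j \<and> k \<in> K then 1 else 0)) = (\<Sum>k\<in>K. if k = j then x (i, k) else 0)" for i j
      by (rule sum.cong) auto
    then show "mul (mat_alg K) x (unt (mat_alg K)) = x"
      using K x by (auto simp: fun_eq_iff cspace_def)
  qed
  show ?thesis
    unfolding star_algebra_def linear_op_def
    by (simp add: assoc unit)
      (auto simp: K cspace_def fun_eq_iff sum.distrib sum_distrib_left distrib_left distrib_right mult_ac)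
qed

lemma star_algebra_diag_alg: "finite K \<Longrightarrow> star_algebra (diag_alg K)"
  by (auto simp: star_algebra_def linear_op_def cspace_def fun_eq_iff algebra_simps)

lemma mat_alg_mul_bvec:
  assumes "finite K"
  shows "mul (mat_alg K) (bvec (i, a)) (bvec (b, j)) = (if a = b \<and> a \<in> K then bvec (i, j) else (\<lambda>_. 0))"
proof
  fix p :: "'a \<times> 'a"
  obtain i' j' where p: "p = (i', j')" by fastforce
  have "(\<Sum>k\<in>K. bvec (i, a) (i', k) * bvec (b, j) (k, j'))
      = (\<Sum>k\<in>K. if k = a then (if a = b then bvec (i, j) (i', j') else (0::complex)) else 0)"
    by (rule sum.cong) (auto simp: bvec_def)
  then show "mul (mat_alg K) (bvec (i, a)) (bvec (b, j)) p
      = (if a = b \<and> a \<in> K then bvec (i, j) else (\<lambda>_. 0)) p"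
    using assms by (simp add: p)
qed

lemma diag_alg_mul_bvec:
  "mul (diag_alg K) (bvec i) (bvec j) = (if i = j then bvec i else (\<lambda>_. 0))"
  by (auto simp: fun_eq_iff bvec_def)

lemma mat_alg_star_bvec: "star (mat_alg K) (bvec (i, j)) = bvec (j, i)"
  by (auto simp: fun_eq_iff bvec_def)

lemma diag_alg_star_bvec: "star (diag_alg K) (bvec i) = bvec i"
  by (auto simp: fun_eq_iff bvec_def)

text \<open>The algebra \<open>\<complex>\<^sup>I \<otimes> M\<^sub>K\<close> consists of families of matrices indexed by \<open>I\<close>, with componentwise operations.
  In this form a unital *-homomorphism into it is just a family of them into \<open>M\<^sub>K\<close>.\<close>

lemma star_diag_mat:
  assumes "finite I" "finite K" "z \<in> cspace (I \<times> K \<times> K)"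
  shows "star (tensor_alg (diag_alg I) (mat_alg K)) z = (\<lambda>(p, i, j). cnj (z (p, j, i)))"
proof
  fix q :: "'a \<times> 'b \<times> 'b"
  obtain p i j where q: "q = (p, i, j)" by (cases q)
  have "star (tensor_alg (diag_alg I) (mat_alg K)) z q
    = (\<Sum>r\<in>I \<times> K \<times> K. if r = (p, j, i) then cnj (z (p, j, i)) else 0)"
    unfolding tensor_alg_def q
    by (auto simp: tens_def diag_alg_star_bvec mat_alg_star_bvec bvec_def intro!: sum.cong
        split: if_splits)
  then show "star (tensor_alg (diag_alg I) (mat_alg K)) z q = (\<lambda>(p, i, j). cnj (z (p, j, i))) q"
    using assms by (auto simp: q cspace_def)
qed

lemma mul_diag_mat:
  assumes I: "finite I" and K: "finite K" and z: "z \<in> cspace (I \<times> K \<times> K)" and w: "w \<in> cspace (I \<times> K \<times> K)"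
  shows "mul (tensor_alg (diag_alg I) (mat_alg K)) z w =
    (\<lambda>(p, i, j). \<Sum>l\<in>K. z (p, i, l) * w (p, l, j))"
proof
  fix q :: "'a \<times> 'b \<times> 'b"
  obtain p i j where q: "q = (p, i, j)" by (cases q)
  let ?S = "I \<times> K \<times> K"
  have inner: "(\<Sum>s\<in>?S. z (p', i', l) * w s *
      tens (mul (diag_alg I) (bvec p') (bvec (fst s))) (mul (mat_alg K) (bvec (i', l)) (bvec (snd s))) q)
    = (if p' = p \<and> i' = i then z (p, i, l) * w (p, l, j) else 0)"
    if "(p', i', l) \<in> ?S" for p' i' l
  proof -
    have "(\<Sum>s\<in>?S. z (p', i', l) * w s *
      tens (mul (diag_alg I) (bvec p') (bvec (fst s))) (mul (mat_alg K) (bvec (i', l)) (bvec (snd s))) q)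
     = (\<Sum>s\<in>?S. if s = (p, l, j) then (if p' = p \<and> i' = i then z (p, i, l) * w (p, l, j) else 0) else 0)"
      using that
      by (intro sum.cong refl)
        (auto simp: q tens_def diag_alg_mul_bvec mat_alg_mul_bvec[OF K] bvec_apply
          simp del: mat_alg_sel(2) diag_alg_sel(2) split: if_splits)
    then show ?thesis using I K w by (auto simp: cspace_def)
  qed
  have "mul (tensor_alg (diag_alg I) (mat_alg K)) z w q
     = (\<Sum>p'\<in>I. \<Sum>i'\<in>K. \<Sum>l\<in>K. \<Sum>s\<in>?S. z (p', i', l) * w s *
      tens (mul (diag_alg I) (bvec p') (bvec (fst s))) (mul (mat_alg K) (bvec (i', l)) (bvec (snd s))) q)"
    by (simp add: tensor_alg_def case_prod_unfold sum.cartesian_product')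
  also have "\<dots> = (\<Sum>p'\<in>I. \<Sum>i'\<in>K. \<Sum>l\<in>K. if p' = p \<and> i' = i then z (p, i, l) * w (p, l, j) else 0)"
    by (intro sum.cong refl inner) auto
  also have "\<dots> = (\<Sum>p'\<in>I. if p' = p then (\<Sum>i'\<in>K. if i' = i then (\<Sum>l\<in>K. z (p, i, l) * w (p, l, j)) else 0) else 0)"
    by (auto intro!: sum.cong)
  also have "\<dots> = (\<Sum>l\<in>K. z (p, i, l) * w (p, l, j))"
    using I K z by (auto simp: cspace_def)
  finally show "mul (tensor_alg (diag_alg I) (mat_alg K)) z w q
      = (\<lambda>(p, i, j). \<Sum>l\<in>K. z (p, i, l) * w (p, l, j)) q"
    by (simp add: q)
qed

section \<open>Comultiplication on \<open>M\<^sub>2\<close> and \<open>\<complex>\<^sup>4\<close>\<close>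

lemma graph_M2_sel [simp]:
  "idx (graph_M2 d) = {..<2} \<times> {..<2}"
  "mul (graph_M2 d) = mul (mat_alg {..<2})"
  "unt (graph_M2 d) = unt (mat_alg {..<2})"
  "star (graph_M2 d) = star (mat_alg {..<2})"
  "state (graph_M2 d) = tau_M2"
  "adj (graph_M2 d) = op_M2 (A_M2 d)"
  by (simp_all add: graph_M2_def star_alg.extend_def qgraph.fields_def)

lemma graph_C4_sel [simp]:
  "idx (graph_C4 d) = {..<4}"
  "mul (graph_C4 d) = mul (diag_alg {..<4})"
  "unt (graph_C4 d) = unt (diag_alg {..<4})"
  "star (graph_C4 d) = star (diag_alg {..<4})"
  "state (graph_C4 d) = tau_C4"
  "adj (graph_C4 d) = op_C4 (A_C4 d)"
  by (simp_all add: graph_C4_def star_alg.extend_def qgraph.fields_def)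

lemma less_2_nat: "(i::nat) < 2 \<longleftrightarrow> i = 0 \<or> i = 1"
  by auto

lemma less_4_nat: "(i::nat) < 4 \<longleftrightarrow> i = 0 \<or> i = 1 \<or> i = 2 \<or> i = 3"
  by auto

lemma sum_less_2: "(\<Sum>i<2. f i) = f 0 + f (1::nat)" for f :: "nat \<Rightarrow> complex"
  by (simp add: numeral_2_eq_2)

lemma sum_less_4: "(\<Sum>i<4. f i) = f 0 + f 1 + f 2 + f (3::nat)" for f :: "nat \<Rightarrow> complex"
  by (simp add: eval_nat_numeral)

lemma sum_2x2: "(\<Sum>p\<in>{..<2} \<times> {..<2}. f p) = f (0, 0) + f (0, 1) + f (1, 0) + f (1, 1)"
  for f :: "nat \<times> nat \<Rightarrow> complex"
proof -
  have "(\<Sum>p\<in>{..<2} \<times> {..<2}. f p) = (\<Sum>i<2. \<Sum>j<2. f (i, j))"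
    by (simp add: sum.cartesian_product)
  then show ?thesis by (simp add: sum_less_2)
qed

interpretation M2: orthogonal_basis "graph_M2 d" "1/2" for d
proof
  show "star_algebra (graph_M2 d)"
    using star_algebra_mat_alg[of "{..<2::nat}"] by (simp add: star_algebra_def)
  show "linear_functional (idx (graph_M2 d)) (state (graph_M2 d))"
    by (simp add: linear_functional_def tau_M2_def sum_less_2 field_simps)
  show "state (graph_M2 d) (unt (graph_M2 d)) = 1"
    by (simp add: tau_M2_def)
  fix p q assume "p \<in> idx (graph_M2 d)" "q \<in> idx (graph_M2 d)"
  then show "inner_of (graph_M2 d) (state (graph_M2 d)) (bvec p) (bvec q)
      = (if p = q then complex_of_real (1/2) else 0)"
    by (cases p; cases q) (auto simp: inner_of_def tau_M2_def mat_alg_star_bvec mat_alg_mul_bvec sum_less_2 less_2_nat bvec_def)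
qed simp

interpretation C4: orthogonal_basis "graph_C4 d" "1/4" for d
proof
  show "star_algebra (graph_C4 d)"
    using star_algebra_diag_alg[of "{..<4::nat}"] by (simp add: star_algebra_def)
  show "linear_functional (idx (graph_C4 d)) (state (graph_C4 d))"
    by (simp add: linear_functional_def tau_C4_def sum_less_4 field_simps)
  show "state (graph_C4 d) (unt (graph_C4 d)) = 1"
    by (simp add: tau_C4_def)
  fix p q assume "p \<in> idx (graph_C4 d)" "q \<in> idx (graph_C4 d)"
  then show "inner_of (graph_C4 d) (state (graph_C4 d)) (bvec p) (bvec q)
      = (if p = q then complex_of_real (1/4) else 0)"
    by (auto simp: inner_of_def tau_C4_def diag_alg_star_bvec diag_alg_mul_bvec sum_less_4 less_4_nat bvec_def)
qed simp

text \<open>That is \<open>m\<^sup>\<dagger>(e\<^sub>i\<^sub>j) = 2 \<Sum>\<^sub>a e\<^sub>i\<^sub>a \<otimes> e\<^sub>a\<^sub>j\<close>: the products of two matrix units that equal \<open>e\<^sub>i\<^sub>j\<close> are the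
  \<open>e\<^sub>i\<^sub>a e\<^sub>a\<^sub>j\<close>, and matrix units have squared norm \<open>1/2\<close>.\<close>

lemma comult_M2:
  assumes "x \<in> cspace ({..<2} \<times> {..<2})"
  shows "comult (graph_M2 d) x ((i, a), (b, j)) = (if a = b \<and> a < 2 then 2 * x (i, j) else 0)"
proof -
  have "(\<Sum>k\<in>{..<2} \<times> {..<2}. x k * cnj (bvec (i, j) k)) = (\<Sum>k\<in>{..<2} \<times> {..<2}. if k = (i, j) then x k else 0)"
    by (rule sum.cong) (auto simp: bvec_def)
  also have "\<dots> = x (i, j)"
    using assms by (subst sum.delta) (auto simp: cspace_def)
  finally show ?thesis
    using assms by (auto simp: M2.comult_eq mat_alg_mul_bvec cspace_def)
qed

text \<open>That is \<open>m\<^sup>\<dagger>(e\<^sub>i) = 4 e\<^sub>i \<otimes> e\<^sub>i\<close>: the minimal projections are mutually orthogonal idempotents of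
  squared norm \<open>1/4\<close>.\<close>

lemma comult_C4:
  assumes "x \<in> cspace {..<4}"
  shows "comult (graph_C4 d) x (i, j) = (if i = j then 4 * x i else 0)"
proof -
  have "(\<Sum>k<4. x k * cnj (bvec i k)) = (\<Sum>k<4. if k = i then x k else 0)"
    by (rule sum.cong) (auto simp: bvec_def)
  also have "\<dots> = x i"
    using assms by (subst sum.delta) (auto simp: cspace_def)
  finally show ?thesis
    using assms by (auto simp: C4.comult_eq diag_alg_mul_bvec cspace_def simp del: diag_alg_sel(2))
qed

lemma mult_map_M2: "mult_map (graph_M2 d) z (i, j) = (if i < 2 \<and> j < 2 then \<Sum>k<2. z ((i, k), (k, j)) else 0)"
proof -
  have "mult_map (graph_M2 d) z (i, j) = (\<Sum>p\<in>{..<2} \<times> {..<2}. \<Sum>q\<in>{..<2} \<times> {..<2}.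
      z (p, q) * mul (mat_alg {..<2}) (bvec p) (bvec q) (i, j))"
    by (simp add: mult_map_def sum.cartesian_product del: mat_alg_sel(2))
  then show ?thesis
    by (auto simp: less_2_nat sum_2x2 mat_alg_mul_bvec bvec_apply sum_less_2 simp del: mat_alg_sel(2))
qed

lemma mult_map_C4: "mult_map (graph_C4 d) z i = (if i < 4 then z (i, i) else 0)"
  by (auto simp: mult_map_def less_4_nat bvec_def sum.cartesian_product[symmetric] sum_less_4)

section \<open>Conjugation by the Pauli matrices\<close>

text \<open>Encode an element of \<open>\<int>\<^sub>2 \<times> \<int>\<^sub>2\<close> as \<open>k = z + 2 x\<close> with bits \<open>z\<close> and \<open>x\<close>, so that addition is bitwise
  exclusive or. The Pauli matrix attached to \<open>k\<close> is \<open>U\<^sub>k = X\<^sup>x Z\<^sup>z\<close>, up to a phase that conjugation does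
  not see.\<close>

abbreviation bitxor :: "nat \<Rightarrow> nat \<Rightarrow> nat" (infixl "\<oplus>" 65) where
  "k \<oplus> s \<equiv> Bit_Operations.xor k s"

text \<open>The action of \<open>X\<^sup>x\<close> on the indices \<open>0, 1\<close> of the standard basis, extended by the identity so that
  conjugation maps matrices supported on these indices to such matrices.\<close>

definition flip :: "nat \<Rightarrow> nat \<Rightarrow> nat" where
  "flip k i = (if 2 \<le> k \<and> i < 2 then 1 - i else i)"

text \<open>This is \<open>b \<mapsto> U\<^sub>k b U\<^sub>k\<^sup>*\<close>: the matrix \<open>Z\<close> changes the sign of off-diagonal entries, and \<open>X\<close> permutes
  rows and columns.\<close>

definition twirl :: "nat \<Rightarrow> (nat \<times> nat \<Rightarrow> complex) \<Rightarrow> nat \<times> nat \<Rightarrow> complex" where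
  "twirl k b = (\<lambda>(i, j). (if odd k \<and> i \<noteq> j then - 1 else 1) * b (flip k i, flip k j))"

lemma flip_less_2 [simp]: "flip k i < 2 \<longleftrightarrow> i < 2"
  by (auto simp: flip_def)

lemma flip_eq_iff [simp]: "flip k i = flip k j \<longleftrightarrow> i = j"
  by (auto simp: flip_def)

lemma flip_flip: "k < 4 \<Longrightarrow> s < 4 \<Longrightarrow> flip k (flip s i) = flip (k \<oplus> s) i"
  by (auto simp: less_4_nat flip_def)

lemma xor_less_4: "k < 4 \<Longrightarrow> s < 4 \<Longrightarrow> k \<oplus> s < 4"
  by (auto simp: less_4_nat)

lemma xor_left_cancel: "k < 4 \<Longrightarrow> s < 4 \<Longrightarrow> t < 4 \<Longrightarrow> k \<oplus> s = k \<oplus> t \<longleftrightarrow> s = t"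
  by (auto simp: less_4_nat)

lemma twirl_cspace: "b \<in> cspace ({..<2} \<times> {..<2}) \<Longrightarrow> twirl k b \<in> cspace ({..<2} \<times> {..<2})"
  by (auto simp: cspace_def twirl_def)

lemma twirl_sum: "twirl k (\<lambda>p. \<Sum>s\<in>S. X s p) = (\<lambda>p. \<Sum>s\<in>S. twirl k (X s) p)"
  by (simp add: twirl_def sum_distrib_left fun_eq_iff)

lemma twirl_add: "twirl k (\<lambda>p. x p + y p) = (\<lambda>p. twirl k x p + twirl k y p)"
  by (simp add: twirl_def distrib_left fun_eq_iff)

lemma twirl_scale: "twirl k (\<lambda>p. c * x p) = (\<lambda>p. c * twirl k x p)"
  by (simp add: twirl_def mult_ac fun_eq_iff)

lemma twirl_mul:
  assumes "x \<in> cspace ({..<2} \<times> {..<2})" "y \<in> cspace ({..<2} \<times> {..<2})"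
  shows "twirl k (mul (mat_alg {..<2}) x y) = mul (mat_alg {..<2}) (twirl k x) (twirl k y)"
proof
  fix p :: "nat \<times> nat"
  obtain i j where p: "p = (i, j)" by fastforce
  show "twirl k (mul (mat_alg {..<2}) x y) p = mul (mat_alg {..<2}) (twirl k x) (twirl k y) p"
  proof (cases "i < 2 \<and> j < 2")
    case True
    then show ?thesis by (auto simp: p twirl_def sum_less_2 less_2_nat flip_def)
  next
    case False
    then show ?thesis using assms by (auto simp: p twirl_def cspace_def)
  qed
qed

lemma twirl_unt: "twirl k (unt (mat_alg {..<2})) = unt (mat_alg {..<2})"
  by (auto simp: fun_eq_iff twirl_def flip_def)

lemma twirl_star: "twirl k (star (mat_alg {..<2}) b) = star (mat_alg {..<2}) (twirl k b)"
  by (auto simp: fun_eq_iff twirl_def)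

text \<open>The \<open>U\<^sub>k\<close> form a projective representation of \<open>\<int>\<^sub>2 \<times> \<int>\<^sub>2\<close>, and the phases cancel under conjugation.\<close>

lemma twirl_twirl:
  assumes "k < 4" "s < 4"
  shows "twirl k (twirl s b) = twirl (k \<oplus> s) b"
  using assms by (simp add: twirl_def fun_eq_iff flip_flip even_xor_iff xor.commute)

text \<open>The Pauli matrices act irreducibly, so averaging over their conjugations projects to the scalars.\<close>

lemma twirl_average:
  assumes "b \<in> cspace ({..<2} \<times> {..<2})"
  shows "(\<Sum>k<4. twirl k b (i, j)) = (if i = j \<and> i < 2 then 4 * tau_M2 b else 0)"
proof (cases "i < 2 \<and> j < 2")
  case True
  then show ?thesis by (auto simp: less_2_nat sum_less_4 sum_less_2 twirl_def flip_def tau_M2_def)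
next
  case False
  then show ?thesis using assms by (auto simp: twirl_def cspace_def)
qed

text \<open>This says \<open>m (\<pi>\<^sub>s \<otimes> \<pi>\<^sub>t) m\<^sup>\<dagger> = 4 \<delta>\<^sub>s\<^sub>t \<pi>\<^sub>s\<close>, where \<open>\<pi>\<^sub>s(b) = U\<^sub>s b U\<^sub>s\<^sup>*\<close>. It is the trace orthogonality of the
  Pauli matrices: \<open>\<Sum>\<^sub>a U\<^sub>s e\<^sub>i\<^sub>a U\<^sub>s\<^sup>* U\<^sub>t e\<^sub>a\<^sub>j U\<^sub>t\<^sup>* = Tr(U\<^sub>s\<^sup>* U\<^sub>t) U\<^sub>s e\<^sub>i\<^sub>j U\<^sub>t\<^sup>*\<close>. It makes sums of distinct \<open>\<pi>\<^sub>s\<close>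
  Schur idempotent, and it is also what compatibility with the comultiplications amounts to.\<close>

lemma twirl_orthogonality:
  assumes b: "b \<in> cspace ({..<2} \<times> {..<2})" and st: "s < 4" "t < 4"
  shows "(\<Sum>k<2. twirl s (\<lambda>p. twirl t (\<lambda>q. comult (graph_M2 d) b (p, q)) (k, j)) (i, k))
    = (if s = t then 4 * twirl s b (i, j) else 0)"
proof (cases "i < 2 \<and> j < 2")
  case True
  then show ?thesis
    using st by (auto simp: twirl_def comult_M2[OF b] sum_less_2 less_2_nat less_4_nat flip_def)
next
  case False
  then have "b (flip s i, flip t j) = 0" "b (flip s i, flip s j) = 0"
    using b by (auto simp: cspace_def)
  then show ?thesis by (cases "s = t") (simp_all add: twirl_def comult_M2[OF b] cong del: if_weak_cong)
qed

section \<open>Adjacency operators\<close>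

text \<open>The subset \<open>S\<^sub>d\<close> of \<open>\<int>\<^sub>2 \<times> \<int>\<^sub>2\<close> for which \<open>A\<^sub>d = \<Sum>\<^bsub>s\<in>S\<^sub>d\<^esub> \<pi>\<^sub>s\<close> and for which the classical graph is the Cayley
  graph of \<open>\<int>\<^sub>2 \<times> \<int>\<^sub>2\<close>. It can be read off from the first row of \<open>A'\<^sub>d\<close>.\<close>

definition connection_set :: "nat \<Rightarrow> nat set" where
  "connection_set d = (if d = 1 then {0} else if d = 2 then {0, 1} else if d = 3 then {0, 2, 3} else {0, 1, 2, 3})"

lemma connection_set_less_4: "s \<in> connection_set d \<Longrightarrow> s < 4"
  by (auto simp: connection_set_def split: if_splits)

lemma finite_connection_set [simp]: "finite (connection_set d)"
  by (simp add: connection_set_def)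

lemma inner_M2_scaled_bvec:
  assumes "i < 2" "j < 2"
  shows "inner_of (mat_alg {..<2}) tau_M2 (\<lambda>q. a * bvec (i, j) q) x = cnj a / 2 * x (i, j)"
  using assms by (auto simp: inner_of_def tau_M2_def sum_less_2 less_2_nat bvec_apply)

text \<open>The factors \<open>\<surd>2\<close> of the orthonormal basis and the \<open>1/2\<close> of the trace cancel: a matrix with respect to
  this basis has the same entries with respect to the matrix units.\<close>

lemma op_M2_coord:
  "op_M2 M x p = (\<Sum>i<4. \<Sum>j<4.
     M ! i ! j * x ([(0, 0), (0, 1), (1, 0), (1, 1)] ! j) * bvec ([(0, 0), (0, 1), (1, 0), (1, 1)] ! i) p)"
  unfolding op_M2_def
proof (intro sum.cong refl)
  fix i j :: nat assume "i \<in> {..<4}" "j \<in> {..<4}"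
  let ?u = "[(0, 0), (0, 1), (1, 0), (1, 1)] :: (nat \<times> nat) list"
  have nth: "onb_M2 ! k = (\<lambda>q. of_real (sqrt 2) * bvec (?u ! k) q)" if "k < 4" for k
    using that by (auto simp: onb_M2_def less_4_nat)
  have "inner_of (mat_alg {..<2}) tau_M2 (onb_M2 ! j) x = of_real (sqrt 2) / 2 * x (?u ! j)"
    using \<open>j \<in> {..<4}\<close> inner_M2_scaled_bvec[of "fst (?u ! j)" "snd (?u ! j)" "of_real (sqrt 2)" x]
    by (auto simp: nth less_4_nat)
  moreover have "of_real (sqrt 2) / 2 * y * (of_real (sqrt 2) * w) = y * w" for y w :: complex
  proof -
    have "of_real (sqrt 2) / 2 * y * (of_real (sqrt 2) * w) = of_real (sqrt 2 * sqrt 2) / 2 * (y * w)"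
      unfolding of_real_mult by (simp add: mult_ac)
    then show ?thesis by simp
  qed
  ultimately show "M ! i ! j * inner_of (mat_alg {..<2}) tau_M2 (onb_M2 ! j) x * (onb_M2 ! i) p
      = M ! i ! j * x (?u ! j) * bvec (?u ! i) p"
    using \<open>i \<in> {..<4}\<close> by (simp only: nth lessThan_iff mult.assoc)
qed

lemma op_M2_twirl:
  "op_M2 (A_M2 d) x (i, j) =
    (if i < 2 \<and> j < 2 then \<Sum>s\<in>connection_set d. twirl s x (i, j) else 0)"
proof -
  consider "i = 0" "j = 0" | "i = 0" "j = 1" | "i = 1" "j = 0" | "i = 1" "j = 1" | "\<not> (i < 2 \<and> j < 2)"
    by linarith
  then show ?thesis
  proof cases
    case 5
    then show ?thesis by (auto simp: op_M2_coord sum_less_4 bvec_apply)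
  qed (cases "d = 1"; cases "d = 2"; cases "d = 3";
      simp add: op_M2_coord sum_less_4 A_M2_def connection_set_def bvec_apply twirl_def flip_def)+
qed

lemma op_C4_xor:
  "op_C4 (A_C4 d) x i = (if i < 4 then \<Sum>s\<in>connection_set d. x (i \<oplus> s) else 0)"
proof -
  consider "i = 0" | "i = 1" | "i = 2" | "i = 3" | "\<not> i < 4" by linarith
  then show ?thesis
  proof cases
    case 5
    then show ?thesis by (auto simp: op_C4_def sum_less_4 bvec_apply)
  qed (cases "d = 1"; cases "d = 2"; cases "d = 3";
      simp add: op_C4_def sum_less_4 A_C4_def connection_set_def bvec_apply)+
qed

text \<open>Both sides of the Schur condition are sums over \<open>S\<^sub>d\<close>; orthogonality kills the terms with \<open>s \<noteq> t\<close>.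
  The constant is \<open>\<delta> = 2\<close>.\<close>

lemma quantum_graph_M2: "quantum_graph (graph_M2 d)"
proof -
  have lin: "linear_op ({..<2} \<times> {..<2}) ({..<2} \<times> {..<2}) (op_M2 (A_M2 d))"
    by (auto simp: linear_op_def cspace_def fun_eq_iff op_M2_twirl twirl_def sum.distrib sum_distrib_left
        distrib_left mult_ac)
  have special: "mult_map (graph_M2 d) (comult (graph_M2 d) x) = (\<lambda>p. 4 * x p)"
    if x: "x \<in> cspace ({..<2} \<times> {..<2})" for x
    using x by (auto simp: fun_eq_iff mult_map_M2 comult_M2[OF x] cspace_def)
  have schur: "mult_map (graph_M2 d) (op_tensor (op_M2 (A_M2 d)) (op_M2 (A_M2 d)) (comult (graph_M2 d) x))
      = (\<lambda>p. 4 * op_M2 (A_M2 d) x p)"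
    if x: "x \<in> cspace ({..<2} \<times> {..<2})" for x
  proof
    fix p :: "nat \<times> nat"
    obtain i j where p: "p = (i, j)" by fastforce
    let ?S = "connection_set d"
    have "(\<Sum>k<2. \<Sum>s\<in>?S. \<Sum>t\<in>?S. twirl s (\<lambda>p. twirl t (\<lambda>q. comult (graph_M2 d) x (p, q)) (k, j)) (i, k))
      = (\<Sum>s\<in>?S. \<Sum>t\<in>?S. \<Sum>k<2. twirl s (\<lambda>p. twirl t (\<lambda>q. comult (graph_M2 d) x (p, q)) (k, j)) (i, k))"
      by (subst sum.swap, subst (2) sum.swap) (rule refl)
    also have "\<dots> = (\<Sum>s\<in>?S. \<Sum>t\<in>?S. if s = t then 4 * twirl s x (i, j) else 0)"
      by (intro sum.cong refl twirl_orthogonality x) (auto dest: connection_set_less_4)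
    also have "\<dots> = (\<Sum>s\<in>?S. 4 * twirl s x (i, j))"
      by (intro sum.cong refl) simp
    finally show "mult_map (graph_M2 d) (op_tensor (op_M2 (A_M2 d)) (op_M2 (A_M2 d)) (comult (graph_M2 d) x)) p
      = 4 * op_M2 (A_M2 d) x p"
      by (simp add: p mult_map_M2 op_tensor_def op_id_def id_op_def op_M2_twirl twirl_sum sum_distrib_left)
  qed
  show ?thesis
    unfolding quantum_graph_def
    by (auto simp: M2.fd_cstar M2.faithful[simplified] lin special schur intro!: exI[of _ "2::real"])
qed

text \<open>The same computation with the translations of \<open>\<int>\<^sub>2 \<times> \<int>\<^sub>2\<close>, whose orthogonality is that of permutation
  matrices with disjoint supports.\<close>

lemma quantum_graph_C4: "quantum_graph (graph_C4 d)"
proof -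
  have lin: "linear_op {..<4} {..<4} (op_C4 (A_C4 d))"
    by (auto simp: linear_op_def cspace_def fun_eq_iff op_C4_xor sum.distrib sum_distrib_left)
  have special: "mult_map (graph_C4 d) (comult (graph_C4 d) x) = (\<lambda>p. 4 * x p)"
    if x: "x \<in> cspace {..<4}" for x
    using x by (auto simp: fun_eq_iff mult_map_C4 comult_C4[OF x] cspace_def)
  have schur: "mult_map (graph_C4 d) (op_tensor (op_C4 (A_C4 d)) (op_C4 (A_C4 d)) (comult (graph_C4 d) x))
      = (\<lambda>p. 4 * op_C4 (A_C4 d) x p)"
    if x: "x \<in> cspace {..<4}" for x
  proof
    fix i :: nat
    let ?S = "connection_set d"
    have "(\<Sum>s\<in>?S. \<Sum>t\<in>?S. comult (graph_C4 d) x (i \<oplus> s, i \<oplus> t)) = (\<Sum>s\<in>?S. 4 * x (i \<oplus> s))" if i: "i < 4"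
    proof (rule sum.cong[OF refl])
      fix s assume s: "s \<in> ?S"
      have "(\<Sum>t\<in>?S. comult (graph_C4 d) x (i \<oplus> s, i \<oplus> t)) = (\<Sum>t\<in>?S. if s = t then 4 * x (i \<oplus> s) else 0)"
        using i s by (intro sum.cong refl) (auto simp: comult_C4[OF x] xor_left_cancel dest!: connection_set_less_4)
      then show "(\<Sum>t\<in>?S. comult (graph_C4 d) x (i \<oplus> s, i \<oplus> t)) = 4 * x (i \<oplus> s)"
        using s by simp
    qed
    then show "mult_map (graph_C4 d) (op_tensor (op_C4 (A_C4 d)) (op_C4 (A_C4 d)) (comult (graph_C4 d) x)) i
        = 4 * op_C4 (A_C4 d) x i"
      by (simp add: mult_map_C4 op_tensor_def op_id_def id_op_def op_C4_xor sum_distrib_left)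
  qed
  show ?thesis
    unfolding quantum_graph_def
    by (auto simp: C4.fd_cstar C4.faithful[simplified] lin special schur intro!: exI[of _ "2::real"])
qed

section \<open>The quantum isomorphism\<close>

text \<open>The operator \<open>b \<otimes> h \<mapsto> \<Sum>\<^sub>k U\<^sub>k b U\<^sub>k\<^sup>* h \<otimes> e\<^sub>k\<close> on \<open>M\<^sub>2 \<otimes> \<complex>\<^sup>2\<close>.\<close>

definition pauli_iso :: "((nat \<times> nat) \<times> nat \<Rightarrow> complex) \<Rightarrow> nat \<times> nat \<Rightarrow> complex" where
  "pauli_iso z = (\<lambda>(h, k). if k < 4 then \<Sum>h'<2. twirl k (\<lambda>p. z (p, h')) (h, h') else 0)"

lemma slice_cspace: "z \<in> cspace (I \<times> J) \<Longrightarrow> (\<lambda>i. z (i, j)) \<in> cspace I"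
  by (auto simp: cspace_def)

lemma pauli_iso_cspace:
  assumes "z \<in> cspace (({..<2} \<times> {..<2}) \<times> {..<2})"
  shows "pauli_iso z \<in> cspace ({..<2} \<times> {..<4})"
  using assms by (auto simp: cspace_def pauli_iso_def twirl_def)

text \<open>The homomorphism attached to \<open>P\<close> has the four conjugations as its components, so the algebraic
  conditions on it are those of each conjugation separately.\<close>

lemma P_tilde_pauli_iso:
  assumes b: "b \<in> cspace ({..<2} \<times> {..<2})"
  shows "P_tilde pauli_iso {..<2} b = (\<lambda>(k, q). if k < 4 then twirl k b q else 0)"
proof -
  have "(\<Sum>h'<2. twirl k (\<lambda>p. tens b (bvec j) (p, h')) (i, h')) = twirl k b (i, j)" if "j < 2" for k i j
    using that by (auto simp: tens_def bvec_apply sum_less_2 less_2_nat twirl_def)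
  moreover have "twirl k b (i, j) = 0" if "\<not> j < 2" for k i j
    using twirl_cspace[OF b, of k] that by (auto simp: cspace_def)
  ultimately show ?thesis
    by (auto simp: fun_eq_iff P_tilde_def pauli_iso_def)
qed

lemma pauli_iso_star_hom:
  "unital_star_hom (graph_M2 d) (tensor_alg (graph_C4 d) (mat_alg {..<2})) (P_tilde pauli_iso {..<2})"
proof -
  let ?M = "cspace ({..<2::nat} \<times> {..<2::nat})"
  let ?T = "tensor_alg (diag_alg {..<4::nat}) (mat_alg {..<2::nat})"
  let ?P = "P_tilde pauli_iso {..<2}"
  have T: "tensor_alg (graph_C4 d) (mat_alg {..<2}) = ?T"
    by (simp add: tensor_alg_def)
  have M: "(\<lambda>i. x i + y i) \<in> ?M" "(\<lambda>i. c * x i) \<in> ?M" "star (mat_alg {..<2}) x \<in> ?M"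
    "mul (mat_alg {..<2}) x y \<in> ?M" "unt (mat_alg {..<2}) \<in> ?M"
    if "x \<in> ?M" "y \<in> ?M" for x y c
    using that by (auto simp: cspace_def)
  have mem: "?P x \<in> cspace ({..<4} \<times> {..<2} \<times> {..<2})" if x: "x \<in> ?M" for x
    using twirl_cspace[OF x] by (auto simp: P_tilde_pauli_iso[OF x] cspace_def)
  have lin: "linear_op ({..<2} \<times> {..<2}) ({..<4} \<times> {..<2} \<times> {..<2}) ?P"
    unfolding linear_op_def
    by (auto simp: mem) (auto simp: P_tilde_pauli_iso M fun_eq_iff twirl_add twirl_scale)
  have mul: "?P (mul (mat_alg {..<2}) x y) = mul ?T (?P x) (?P y)" if x: "x \<in> ?M" and y: "y \<in> ?M" for x y
    using mem[OF x] mem[OF y]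
    by (simp add: mul_diag_mat) (auto simp: fun_eq_iff P_tilde_pauli_iso M x y twirl_mul)
  have star: "?P (star (mat_alg {..<2}) x) = star ?T (?P x)" if x: "x \<in> ?M" for x
    using mem[OF x]
    by (simp add: star_diag_mat) (auto simp: fun_eq_iff P_tilde_pauli_iso M(3)[OF x x] x twirl_star)
  have unt: "?P (unt (mat_alg {..<2})) = unt ?T"
    by (subst P_tilde_pauli_iso) (auto simp: M(5)[OF zero_cspace zero_cspace] twirl_unt fun_eq_iff tensor_alg_def tens_def)
  show ?thesis
    unfolding T unital_star_hom_def
    using lin mul star unt by (simp add: tensor_alg_def)
qed

text \<open>Applying \<open>P\<close> twice after \<open>m\<^sup>\<dagger>\<close> yields the components \<open>m (\<pi>\<^sub>k \<otimes> \<pi>\<^sub>l) m\<^sup>\<dagger>\<close>, which are supported on \<open>k = l\<close>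
  with factor \<open>4\<close>, which is the form of \<open>m'\<^sup>\<dagger>\<close> on \<open>\<complex>\<^sup>4\<close>.\<close>

lemma pauli_iso_comult:
  assumes z: "z \<in> cspace (({..<2} \<times> {..<2}) \<times> {..<2})"
  shows "op_id pauli_iso (assoc_left (id_op pauli_iso (assoc_right (op_id (comult (graph_M2 d)) z))))
    = assoc_left (id_op (comult (graph_C4 d)) (pauli_iso z))"
proof
  fix q :: "(nat \<times> nat) \<times> nat"
  obtain h k l where q: "q = ((h, k), l)" by (metis prod.collapse)
  have "(\<Sum>h'<2. twirl k (\<lambda>p. \<Sum>h''<2. twirl l (\<lambda>r. comult (graph_M2 d) (\<lambda>i. z (i, h'')) (p, r)) (h', h'')) (h, h'))
      = (if k = l then 4 * pauli_iso z (h, k) else 0)" if kl: "k < 4" "l < 4"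
  proof -
    have "(\<Sum>h'<2. twirl k (\<lambda>p. \<Sum>h''<2. twirl l (\<lambda>r. comult (graph_M2 d) (\<lambda>i. z (i, h'')) (p, r)) (h', h'')) (h, h'))
      = (\<Sum>h''<2. \<Sum>h'<2. twirl k (\<lambda>p. twirl l (\<lambda>r. comult (graph_M2 d) (\<lambda>i. z (i, h'')) (p, r)) (h', h'')) (h, h'))"
      by (simp only: twirl_sum) (rule sum.swap)
    also have "\<dots> = (\<Sum>h''<2. if k = l then 4 * twirl k (\<lambda>i. z (i, h'')) (h, h'') else 0)"
      by (intro sum.cong refl twirl_orthogonality kl slice_cspace[OF z])
    finally show ?thesis using kl by (simp add: pauli_iso_def sum_distrib_left)
  qed
  moreover have "comult (graph_C4 d) (\<lambda>j. pauli_iso z (h, j)) (k, l) = (if k = l then 4 * pauli_iso z (h, k) else 0)"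
    using pauli_iso_cspace[OF z] by (intro comult_C4) (auto simp: cspace_def)
  ultimately show "op_id pauli_iso (assoc_left (id_op pauli_iso (assoc_right (op_id (comult (graph_M2 d)) z)))) q
      = assoc_left (id_op (comult (graph_C4 d)) (pauli_iso z)) q"
    by (cases "k < 4"; cases "l < 4")
     (auto simp: q op_id_def id_op_def assoc_left_def assoc_right_def pauli_iso_def twirl_def)
qed

text \<open>Conjugation turns translation in the index into composition: \<open>\<pi>\<^sub>k A\<^sub>d = \<Sum>\<^sub>s \<pi>\<^sub>k \<pi>\<^sub>s = \<Sum>\<^sub>s \<pi>\<^bsub>k+s\<^esub>\<close>.\<close>

lemma pauli_iso_intertwines:
  assumes z: "z \<in> cspace (({..<2} \<times> {..<2}) \<times> {..<2})"
  shows "pauli_iso (op_id (op_M2 (A_M2 d)) z) = id_op (op_C4 (A_C4 d)) (pauli_iso z)"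
proof
  fix q :: "nat \<times> nat"
  obtain h k where q: "q = (h, k)" by fastforce
  let ?S = "connection_set d"
  show "pauli_iso (op_id (op_M2 (A_M2 d)) z) q = id_op (op_C4 (A_C4 d)) (pauli_iso z) q"
  proof (cases "h < 2 \<and> k < 4")
    case True
    have "pauli_iso (op_id (op_M2 (A_M2 d)) z) q
        = (\<Sum>h'<2. twirl k (\<lambda>p. \<Sum>s\<in>?S. twirl s (\<lambda>i. z (i, h')) p) (h, h'))"
      using True by (auto simp: q pauli_iso_def op_id_def twirl_def op_M2_twirl intro!: sum.cong)
    also have "\<dots> = (\<Sum>s\<in>?S. \<Sum>h'<2. twirl k (twirl s (\<lambda>i. z (i, h'))) (h, h'))"
      by (simp only: twirl_sum) (rule sum.swap)
    also have "\<dots> = (\<Sum>s\<in>?S. pauli_iso z (h, k \<oplus> s))"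
      using True by (intro sum.cong refl)
        (auto simp: pauli_iso_def twirl_twirl xor_less_4 dest!: connection_set_less_4)
    also have "\<dots> = id_op (op_C4 (A_C4 d)) (pauli_iso z) q"
      using True by (simp add: q id_op_def op_C4_xor)
    finally show ?thesis .
  next
    case False
    have "pauli_iso z (h, l) = 0" if "\<not> h < 2" for l
      using pauli_iso_cspace[OF z] that by (auto simp: cspace_def)
    then show ?thesis
      using False by (auto simp: q id_op_def op_C4_xor pauli_iso_def op_id_def op_M2_twirl twirl_def)
  qed
qed

text \<open>The compatibility with the states is the statement that the average of the \<open>\<pi>\<^sub>k(b)\<close> is \<open>\<tau>(b) 1\<close>.\<close>

lemma quantum_isomorphism_pauli_iso:
  "quantum_isomorphism {..<2} pauli_iso (graph_C4 d) (graph_M2 d)"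
proof -
  let ?Z = "({..<2::nat} \<times> {..<2::nat}) \<times> {..<2::nat}"
  have lin: "linear_op ?Z ({..<2} \<times> {..<4}) pauli_iso"
    unfolding linear_op_def
  proof (intro conjI ballI allI)
    fix x y :: "(nat \<times> nat) \<times> nat \<Rightarrow> complex" and c :: complex
    show "pauli_iso (\<lambda>i. x i + y i) = (\<lambda>j. pauli_iso x j + pauli_iso y j)"
      by (auto simp: pauli_iso_def fun_eq_iff twirl_add sum.distrib)
    show "pauli_iso (\<lambda>i. c * x i) = (\<lambda>j. c * pauli_iso x j)"
      by (auto simp: pauli_iso_def fun_eq_iff twirl_scale sum_distrib_left)
  qed (rule pauli_iso_cspace)
  have state: "id_fun tau_C4 (pauli_iso z) = fun_id tau_M2 z" if z: "z \<in> cspace ?Z" for z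
  proof
    fix h
    have "(\<Sum>k<4. pauli_iso z (h, k)) = (\<Sum>h'<2. \<Sum>k<4. twirl k (\<lambda>p. z (p, h')) (h, h'))"
      unfolding pauli_iso_def by (subst sum.swap) (simp cong: sum.cong_simp)
    also have "\<dots> = (\<Sum>h'<2. if h' = h then 4 * tau_M2 (\<lambda>p. z (p, h')) else 0)"
      by (intro sum.cong refl) (auto simp: twirl_average[OF slice_cspace[OF z]])
    also have "\<dots> = 4 * tau_M2 (\<lambda>p. z (p, h))"
      using z by (auto simp: tau_M2_def cspace_def)
    finally show "id_fun tau_C4 (pauli_iso z) h = fun_id tau_M2 z h"
      by (simp add: id_fun_def fun_id_def tau_C4_def)
  qed
  show ?thesis
    unfolding quantum_isomorphism_def
    using lin state pauli_iso_star_hom pauli_iso_comult pauli_iso_intertwines by simp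
qed

theorem corollary4p9:
  fixes d :: nat
  assumes "d \<in> {1, 2, 3, 4}"
  shows "quantum_graph (graph_M2 d) \<and> quantum_graph (graph_C4 d) \<and>
         quantum_isomorphic (graph_C4 d) (graph_M2 d)"
proof -
  \<comment> \<open>\<open>P\<close> maps \<open>e\<^sub>1\<^sub>1 \<otimes> h\<^sub>1\<close> to a vector whose component at \<open>k = 0\<close> is \<open>e\<^sub>1\<^sub>1 h\<^sub>1 = h\<^sub>1\<close>.\<close>
  let ?e = "bvec ((0, 0), 0) :: (nat \<times> nat) \<times> nat \<Rightarrow> complex"
  have "pauli_iso ?e (0, 0) = 1"
    by (simp add: pauli_iso_def twirl_def flip_def sum_less_2 bvec_apply)
  then have "pauli_iso ?e \<noteq> (\<lambda>_. 0)" by auto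
  moreover have "?e \<in> cspace (idx (graph_M2 d) \<times> {..<2})" by simp
  ultimately show ?thesis
    unfolding quantum_isomorphic_def
    using quantum_graph_M2 quantum_graph_C4 quantum_isomorphism_pauli_iso by blast
qed

end
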